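(* Let $\kappa>0$ and let $(f,(c_n)_{n\ge1})$ be the solution of $$\partial_t c_n=J_{n-1}-J_n\ (n\ge1),\qquad \partial_t f=-\sum_{n=0}^\infty J_n,$$ $$J_n=\kappa n f c_n-(n+1)c_{n+1}\ (n\ge1),\qquad J_0=-c_1,$$ with nonnegative initial data of finite mass $\rho=f(0)+\sum_{n=1}^\infty n c_n(0)<\infty$, where $\rho>\frac1\kappa$ and $f(0)<\rho$. Let $C_k(t)=\sum_{n=k}^\infty c_n(t)$ for $k\ge1$. Then $$tC_{\lfloor tx\rfloor+1}(t)\ \overset{*}{\rightharpoonup}\ \Big(\rho-\frac1\kappa\Big)e^{-x}\quad\text{in }L^\infty([0,\infty))\text{ as }t\to\infty$$ (as functions of $x$). Furthermore, let $0<a<T<\infty$. For all $1\le p<\infty$ and $M<\infty$ it holds that $$tC_{\lfloor tx\rfloor+1}(ts)\to\Big(\rho-\frac1\kappa\Big)\frac1s e^{-\frac xs}$$ in $C([a,T],L^p((0,M)))$ as $t\to\infty$, where $s\in[a,T]$ is the time variable and $x\in(0,M)$ the space variable.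
   Context: A solution is a family of nonnegative functions $f,c_n:[0,\infty)\to[0,\infty)$ ($n\ge1$), continuously differentiable, satisfying the stated differential equations for all $t\ge 0$ with the prescribed initial data, and conserving mass: $f(t)+\sum_{n=1}^\infty n c_n(t)=\rho$ for all $t\ge0$. Well-posedness of the system for nonnegative initial data of finite mass is taken as known. Weak* convergence in $L^\infty$ means convergence when tested against every function in $L^1$. Here $\lfloor\cdot\rfloor$ is the floor function. *)

theory Defs
  imports "HOL-Analysis.Analysis"
begin

text \<open>
  Cluster concentrations are functions \<open>c :: nat \<Rightarrow> real \<Rightarrow> real\<close>, where \<open>c n t\<close> is meaningful for
  \<open>n \<ge> 1\<close> and \<open>t \<ge> 0\<close> only; neither \<open>c 0\<close> nor the values at negative times play any role.
\<close>

definition flux :: "real \<Rightarrow> (real \<Rightarrow> real) \<Rightarrow> (nat \<Rightarrow> real \<Rightarrow> real) \<Rightarrow> nat \<Rightarrow> real \<Rightarrow> real" where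
  "flux \<kappa> f c n t =
     (if n = 0 then - c 1 t else \<kappa> * real n * f t * c n t - real (n + 1) * c (n + 1) t)"

text \<open>At \<open>t = 0\<close> the derivative is the one-sided one.\<close>

definition has_C1_derivative :: "(real \<Rightarrow> real) \<Rightarrow> (real \<Rightarrow> real) \<Rightarrow> bool" where
  "has_C1_derivative g g' \<longleftrightarrow>
     (\<forall>t\<ge>0. (g has_real_derivative g' t) (at t within {0..})) \<and> continuous_on {0..} g'"

text \<open>
  The term with index \<open>0\<close> of the series in the last clause vanishes, so that clause says
  \<open>f t + (\<Sum>n\<ge>1. n * c n t) = \<rho>\<close>, convergence of the series included. At \<open>t = 0\<close> it says that the
  initial data have finite mass \<open>\<rho>\<close>.
\<close>

definition cluster_solution ::
  "real \<Rightarrow> real \<Rightarrow> (real \<Rightarrow> real) \<Rightarrow> (nat \<Rightarrow> real \<Rightarrow> real) \<Rightarrow> bool" where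
  "cluster_solution \<kappa> \<rho> f c \<longleftrightarrow>
     (\<forall>t\<ge>0. f t \<ge> 0) \<and>
     (\<forall>n\<ge>1. \<forall>t\<ge>0. c n t \<ge> 0) \<and>
     (\<forall>n\<ge>1. has_C1_derivative (c n) (\<lambda>t. flux \<kappa> f c (n - 1) t - flux \<kappa> f c n t)) \<and>
     (\<forall>t\<ge>0. summable (\<lambda>n. flux \<kappa> f c n t)) \<and>
     has_C1_derivative f (\<lambda>t. - (\<Sum>n. flux \<kappa> f c n t)) \<and>
     (\<forall>t\<ge>0. (\<lambda>n. real n * c n t) sums (\<rho> - f t))"

definition tail_sum :: "(nat \<Rightarrow> real \<Rightarrow> real) \<Rightarrow> nat \<Rightarrow> real \<Rightarrow> real" where
  "tail_sum c k t = (\<Sum>n. c (k + n) t)"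

definition in_Linf :: "real set \<Rightarrow> (real \<Rightarrow> real) \<Rightarrow> bool" where
  "in_Linf S u \<longleftrightarrow> u \<in> borel_measurable (lebesgue_on S) \<and>
     (\<exists>K. AE x in lebesgue_on S. \<bar>u x\<bar> \<le> K)"

definition weak_star_Linf ::
  "real set \<Rightarrow> ('t \<Rightarrow> real \<Rightarrow> real) \<Rightarrow> (real \<Rightarrow> real) \<Rightarrow> 't filter \<Rightarrow> bool" where
  "weak_star_Linf S u v F \<longleftrightarrow>
     (\<forall>\<^sub>F t in F. in_Linf S (u t)) \<and> in_Linf S v \<and>
     (\<forall>\<phi>. integrable (lebesgue_on S) \<phi> \<longrightarrow>
        ((\<lambda>t. LINT x|lebesgue_on S. u t x * \<phi> x) \<longlongrightarrow> (LINT x|lebesgue_on S. v x * \<phi> x)) F)"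

definition in_Lp :: "real \<Rightarrow> real set \<Rightarrow> (real \<Rightarrow> real) \<Rightarrow> bool" where
  "in_Lp p S u \<longleftrightarrow> u \<in> borel_measurable (lebesgue_on S) \<and>
     integrable (lebesgue_on S) (\<lambda>x. \<bar>u x\<bar> powr p)"

definition Lp_norm :: "real \<Rightarrow> real set \<Rightarrow> (real \<Rightarrow> real) \<Rightarrow> real" where
  "Lp_norm p S u = (LINT x|lebesgue_on S. \<bar>u x\<bar> powr p) powr (1 / p)"

definition in_C_Lp :: "real set \<Rightarrow> real \<Rightarrow> real set \<Rightarrow> (real \<Rightarrow> real \<Rightarrow> real) \<Rightarrow> bool" where
  "in_C_Lp I p S u \<longleftrightarrow> (\<forall>s\<in>I. in_Lp p S (u s)) \<and>
     (\<forall>s\<in>I. ((\<lambda>r. Lp_norm p S (\<lambda>x. u r x - u s x)) \<longlongrightarrow> 0) (at s within I))"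

text \<open>
  For compact \<open>I\<close>: convergence in the norm \<open>sup {Lp_norm p S (u s) | s. s \<in> I}\<close> of \<open>C(I, L^p(S))\<close>.
\<close>

definition converges_C_Lp :: "real set \<Rightarrow> real \<Rightarrow> real set \<Rightarrow>
    ('t \<Rightarrow> real \<Rightarrow> real \<Rightarrow> real) \<Rightarrow> (real \<Rightarrow> real \<Rightarrow> real) \<Rightarrow> 't filter \<Rightarrow> bool" where
  "converges_C_Lp I p S u v F \<longleftrightarrow>
     (\<forall>\<^sub>F t in F. in_C_Lp I p S (u t)) \<and> in_C_Lp I p S v \<and>
     uniform_limit I (\<lambda>t s. Lp_norm p S (\<lambda>x. u t s x - v s x)) (\<lambda>s. 0) F"

end

theory Submission
  imports Defs "HOL-Real_Asymp.Real_Asymp"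
begin

text \<open>
  The rate of every reaction is linear in the cluster size, so the mass \<open>m = \<rho> - f\<close> in clusters
  satisfies the closed logistic equation \<open>m' = (\<kappa> f - 1) m\<close> and tends to \<open>\<rho> - 1/\<kappa>\<close>; its reciprocal
  is the explicit function of lemma \<open>inverse_mass\<close>. With \<open>f\<close> known, \<open>(c\<^sub>n)\<close> solves the Kolmogorov
  equation of a linear birth and death process, absorbed at size \<open>0\<close>, in which each monomer of a
  cluster gives birth at rate \<open>\<kappa> f\<close> and dies at rate \<open>1\<close>. The generating function \<open>G(t, z) = \<Sum>n\<ge>1. c\<^sub>n(t) z^n\<close> solves the transport equation
  \<open>\<partial>\<^sub>t G = - c\<^sub>1 + (1 - z) (1 - \<kappa> f z) \<partial>\<^sub>z G\<close>. Along a characteristic \<open>z(t)\<close> the function \<open>G\<close> changes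
  only by the loss \<open>- c\<^sub>1\<close> of clusters, which is the same for all characteristics. Hence the deficit
  \<open>H(t, z) = G(t, 1) - G(t, z)\<close> is constant along characteristics (lemma \<open>deficit_conserved\<close>).

  The characteristics are explicit because the odds \<open>v = z / (1 - z)\<close> satisfy the linear equation
  \<open>v' = (\<kappa> f - 1) v - 1\<close>, in other words \<open>(v / m)' = - 1 / m\<close>. Traced back from the point \<open>(t, z)\<close>
  to time \<open>0\<close>, a characteristic starts at odds \<open>m(0) (v / m(t) + P(t))\<close> with
  \<open>P(t) = \<integral>\<^sub>0\<^sup>t 1/m\<close>, which grows like \<open>t / (\<rho> - 1/\<kappa>)\<close>. So for large \<open>t\<close> the starting point is
  close to \<open>1\<close>, where \<open>H(0, z)\<close> behaves like \<open>m(0) (1 - z)\<close>: of the initial data only the mass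
  survives. For \<open>z = exp (- q / t)\<close> this gives
  \<open>t * (\<Sum>n\<ge>1. c\<^sub>n(t) exp (- q n / t)) \<longlongrightarrow> (\<rho> - 1/\<kappa>) / (q + 1)\<close> for \<open>q = 0, 1, 2, \<dots>\<close>
  (lemma \<open>moment_limit\<close>).

  The right-hand sides are \<open>\<rho> - 1/\<kappa>\<close> times the moments \<open>\<integral>\<^sub>0\<^sup>1 y^q dy\<close> of the uniform distribution,
  in the variable \<open>y = exp (- n / t)\<close>. By the Weierstrass approximation theorem and the monotonicity
  of distribution functions, the convergence of moments implies that of
  \<open>t * (\<Sum>n\<ge>1. c\<^sub>n(t) [exp (- n / t) < b])\<close> to \<open>(\<rho> - 1/\<kappa>) b\<close>, uniformly in \<open>b \<in> [0, 1]\<close>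
  (locale \<open>uniform_moment_limit\<close>). For \<open>b = exp (- x)\<close> the sum is the scaled tail \<open>t C\<^sub>k(t)\<close> with
  \<open>k = \<lfloor>t x\<rfloor> + 1\<close>. The result is convergence uniformly in \<open>x \<ge> 0\<close>
  (lemma \<open>scaled_tail_uniform_limit\<close>), which is stronger than both claims: the weak* limit follows by
  dominated convergence, and the limit in \<open>C([a, T], L\<^sup>p)\<close> by replacing \<open>t\<close> with \<open>t s \<ge> t a\<close>.
\<close>

section \<open>Distribution functions from moments\<close>

lemma weighted_sum_bound:
  fixes w h :: "nat \<Rightarrow> real"
  assumes "summable w" "\<And>n. 0 \<le> w n" "\<And>n. \<bar>h n\<bar> \<le> K"
  shows "summable (\<lambda>n. w n * h n)" and "\<bar>\<Sum>n. w n * h n\<bar> \<le> K * (\<Sum>n. w n)"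
proof -
  have bound: "\<bar>w n * h n\<bar> \<le> K * w n" for n
    using mult_left_mono[OF assms(3)[of n] assms(2)[of n]] assms(2)[of n]
    by (simp add: abs_mult mult.commute)
  have K: "summable (\<lambda>n. K * w n)"
    using assms(1) by (rule summable_mult)
  show *: "summable (\<lambda>n. w n * h n)"
    using bound by (intro summable_comparison_test'[OF K]) auto
  have abs: "summable (\<lambda>n. \<bar>w n * h n\<bar>)"
    using bound by (intro summable_comparison_test'[OF K]) auto
  have "\<bar>\<Sum>n. w n * h n\<bar> \<le> (\<Sum>n. \<bar>w n * h n\<bar>)"
    by (rule summable_rabs[OF abs])
  also have "\<dots> \<le> (\<Sum>n. K * w n)"
    by (rule suminf_le[OF bound abs K])
  also have "\<dots> = K * (\<Sum>n. w n)"
    by (rule suminf_mult[OF assms(1)])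
  finally show "\<bar>\<Sum>n. w n * h n\<bar> \<le> K * (\<Sum>n. w n)" .
qed

lemma integral_power_unit_interval: "((\<lambda>x::real. x ^ i) has_integral 1 / (real i + 1)) {0..1}"
proof -
  have "((\<lambda>x::real. x ^ i) has_integral 1 ^ Suc i / real (Suc i) - 0 ^ Suc i / real (Suc i)) {0..1}"
    by (rule fundamental_theorem_of_calculus)
       (auto intro!: derivative_eq_intros simp del: of_nat_Suc power_Suc
             simp flip: has_real_derivative_iff_has_vector_derivative)
  then show ?thesis by (simp add: add.commute)
qed

text \<open>
  A continuous substitute for the indicator function of \<open>{..<b}\<close>, descending from \<open>1\<close> to \<open>0\<close> on
  \<open>[b - d, b]\<close>.
\<close>

definition ramp :: "real \<Rightarrow> real \<Rightarrow> real \<Rightarrow> real" where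
  "ramp b d x = max 0 (min 1 ((b - x) / d))"

lemma ramp_bounds:
  assumes "d > 0"
  shows "0 \<le> ramp b d x" "ramp b d x \<le> 1" "x \<le> b - d \<Longrightarrow> ramp b d x = 1" "x \<ge> b \<Longrightarrow> ramp b d x = 0"
  using assms by (auto simp: ramp_def field_simps)

lemma continuous_on_ramp: "continuous_on S (ramp b d)"
  unfolding ramp_def by (cases "d = 0") (auto intro!: continuous_intros)

lemma integral_ramp_le:
  assumes "d > 0" "0 \<le> b"
  shows "integral {0..1} (ramp b d) \<le> b"
proof (cases "b \<le> 1")
  case True
  have "integral {0..1} (ramp b d) = integral {0..b} (ramp b d) + integral {b..1} (ramp b d)"
    using True assms
    by (intro Henstock_Kurzweil_Integration.integral_combine[symmetric]
        integrable_continuous_interval continuous_on_ramp) auto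
  also have "integral {b..1} (ramp b d) = integral {b..1} (\<lambda>x. 0)"
    using assms by (intro integral_cong) (auto simp: ramp_bounds)
  also have "integral {0..b} (ramp b d) \<le> integral {0..b} (\<lambda>x. 1)"
    using assms
    by (intro integral_le integrable_continuous_interval continuous_on_ramp)
       (auto simp: ramp_bounds)
  finally show ?thesis using assms by simp
next
  case False
  have "integral {0..1} (ramp b d) \<le> integral {0..1} (\<lambda>x::real. 1)"
    using assms
    by (intro integral_le integrable_continuous_interval continuous_on_ramp)
       (auto simp: ramp_bounds)
  then show ?thesis using False by simp
qed

lemma integral_ramp_ge:
  assumes "d > 0" "b \<le> 1"
  shows "b - d \<le> integral {0..1} (ramp b d)"
proof (cases "0 \<le> b - d")
  case True
  have "b - d = integral {0..b - d} (\<lambda>x. 1)"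
    using True by simp
  also have "\<dots> = integral {0..b - d} (ramp b d)"
    using assms by (intro integral_cong) (auto simp: ramp_bounds)
  also have "\<dots> \<le> integral {0..1} (ramp b d)"
    using assms True
    by (intro integral_subset_le integrable_continuous_interval continuous_on_ramp)
       (auto simp: ramp_bounds)
  finally show ?thesis .
next
  case False
  have "0 \<le> integral {0..1} (ramp b d)"
    using assms by (intro integral_nonneg integrable_continuous_interval continuous_on_ramp)
       (auto simp: ramp_bounds)
  then show ?thesis using False by simp
qed

text \<open>
  The weights \<open>w t n\<close> at the points \<open>y t n\<close> form a discrete measure on the unit interval. Its moments
  tend to those of \<open>\<mu>\<close> times the uniform distribution, and a finite measure on a compact interval is
  determined by its moments.
\<close>

locale uniform_moment_limit =
  fixes w y :: "'t \<Rightarrow> nat \<Rightarrow> real" and F :: "'t filter" and \<mu> :: real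
  assumes weights: "\<forall>\<^sub>F t in F. summable (w t) \<and> (\<forall>n. 0 \<le> w t n \<and> 0 \<le> y t n \<and> y t n \<le> 1)"
    and moments: "\<And>q. ((\<lambda>t. \<Sum>n. w t n * y t n ^ q) \<longlongrightarrow> \<mu> / (real q + 1)) F"
    and limit_nonneg: "0 \<le> \<mu>"
begin

lemma total_mass_eventually_less: "\<forall>\<^sub>F t in F. (\<Sum>n. w t n) < \<mu> + 1"
  using order_tendstoD(2)[OF moments[of 0], of "\<mu> + 1"] by simp

lemma polynomial_average:
  assumes "real_polynomial_function p"
  shows "((\<lambda>t. \<Sum>n. w t n * p (y t n)) \<longlongrightarrow> \<mu> * integral {0..1} p) F"
proof -
  obtain a N where p: "p = (\<lambda>x. \<Sum>i\<le>N. a i * x ^ i)"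
    using assms real_polynomial_function_iff_sum by blast
  have "(p has_integral (\<Sum>i\<le>N. a i * (1 / (real i + 1)))) {0..1}"
    unfolding p
    by (intro has_integral_sum has_integral_mult_right integral_power_unit_interval) auto
  then have int: "\<mu> * integral {0..1} p = (\<Sum>i\<le>N. a i * (\<mu> / (real i + 1)))"
    by (simp add: integral_unique sum_distrib_left mult_ac)
  have lim: "((\<lambda>t. \<Sum>i\<le>N. a i * (\<Sum>n. w t n * y t n ^ i)) \<longlongrightarrow> \<mu> * integral {0..1} p) F"
    unfolding int by (intro tendsto_intros moments)
  have "\<forall>\<^sub>F t in F. (\<Sum>i\<le>N. a i * (\<Sum>n. w t n * y t n ^ i)) = (\<Sum>n. w t n * p (y t n))"
    using weights
  proof eventually_elim
    case (elim t)
    have s: "summable (\<lambda>n. w t n * y t n ^ i)" for i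
      using elim by (intro weighted_sum_bound(1)[where K=1]) (auto simp: power_le_one)
    have "(\<Sum>n. w t n * p (y t n)) = (\<Sum>n. \<Sum>i\<le>N. a i * (w t n * y t n ^ i))"
      by (simp add: p sum_distrib_left mult_ac)
    also have "\<dots> = (\<Sum>i\<le>N. \<Sum>n. a i * (w t n * y t n ^ i))"
      by (rule suminf_sum) (intro summable_mult s)
    also have "\<dots> = (\<Sum>i\<le>N. a i * (\<Sum>n. w t n * y t n ^ i))"
      by (intro sum.cong refl suminf_mult s)
    finally show ?case by simp
  qed
  then show ?thesis
    using lim by (rule Lim_transform_eventually[rotated])
qed

text \<open>
  Weierstrass approximation: replacing \<open>g\<close> by a polynomial at distance \<open>d\<close> costs at most \<open>d\<close> times the
  total weight, and the total weight is the zeroth moment, hence bounded.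
\<close>

lemma continuous_average:
  assumes g: "continuous_on {0..1} g"
  shows "((\<lambda>t. \<Sum>n. w t n * g (y t n)) \<longlongrightarrow> \<mu> * integral {0..1} g) F"
proof (rule tendstoI)
  fix e :: real
  assume e: "e > 0"
  define d where "d = (e / 3) / (\<mu> + 1)"
  have "\<mu> + 1 \<noteq> 0"
    using limit_nonneg by linarith
  then have d: "d * (\<mu> + 1) = e / 3" "d > 0"
    using e limit_nonneg by (metis d_def nonzero_eq_divide_eq, simp add: d_def)
  obtain p where p: "real_polynomial_function p" and gp: "\<And>x. x \<in> {0..1} \<Longrightarrow> \<bar>g x - p x\<bar> < d"
    using Stone_Weierstrass_real_polynomial_function[OF compact_Icc g d(2)] by metis
  have pc: "continuous_on {0..1} p"
    using p by (intro continuous_on_polymonial_function) (simp add: real_polynomial_function_eq)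
  have "norm (integral {0..1} (\<lambda>x. g x - p x)) \<le> d * (1 - 0)"
    using gp by (intro integral_bound continuous_intros g pc) (auto intro: less_imp_le)
  then have int: "\<bar>integral {0..1} g - integral {0..1} p\<bar> \<le> d"
    by (simp add: integral_diff integrable_continuous_interval g pc)
  have "\<bar>\<mu> * integral {0..1} p - \<mu> * integral {0..1} g\<bar> = \<mu> * \<bar>integral {0..1} g - integral {0..1} p\<bar>"
    using limit_nonneg by (simp add: abs_mult abs_minus_commute flip: right_diff_distrib)
  also have "\<dots> \<le> e / 3"
    using mult_left_mono[OF int limit_nonneg] d by (simp add: algebra_simps)
  finally have 3: "\<bar>\<mu> * integral {0..1} p - \<mu> * integral {0..1} g\<bar> \<le> e / 3" .
  have "\<forall>\<^sub>F t in F. \<bar>(\<Sum>n. w t n * p (y t n)) - \<mu> * integral {0..1} p\<bar> < e / 3"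
    using tendstoD[OF polynomial_average[OF p], of "e / 3"] e by (simp add: dist_real_def)
  then show "\<forall>\<^sub>F t in F. dist (\<Sum>n. w t n * g (y t n)) (\<mu> * integral {0..1} g) < e"
    using weights total_mass_eventually_less
  proof eventually_elim
    case (elim t)
    have b: "\<bar>g (y t n) - p (y t n)\<bar> \<le> d" for n
      using gp[of "y t n"] elim by auto
    obtain K where K: "\<And>x. x \<in> {0..1} \<Longrightarrow> \<bar>g x\<bar> \<le> K"
      using continuous_on_compact_bound[OF compact_Icc g] by (metis real_norm_def)
    obtain L where L: "\<And>x. x \<in> {0..1} \<Longrightarrow> \<bar>p x\<bar> \<le> L"
      using continuous_on_compact_bound[OF compact_Icc pc] by (metis real_norm_def)
    have sg: "summable (\<lambda>n. w t n * g (y t n))"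
      using elim K by (intro weighted_sum_bound(1)[where K=K]) auto
    have sp: "summable (\<lambda>n. w t n * p (y t n))"
      using elim L by (intro weighted_sum_bound(1)[where K=L]) auto
    have "\<bar>\<Sum>n. w t n * (g (y t n) - p (y t n))\<bar> \<le> d * (\<Sum>n. w t n)"
      using elim b by (intro weighted_sum_bound(2)) auto
    also have "\<dots> < d * (\<mu> + 1)"
      using elim d(2) by (intro mult_strict_left_mono) auto
    finally have "\<bar>(\<Sum>n. w t n * g (y t n)) - (\<Sum>n. w t n * p (y t n))\<bar> < e / 3"
      using d(1) by (simp add: right_diff_distrib suminf_diff[OF sg sp])
    then show ?case
      using elim(1) 3 unfolding dist_real_def by linarith
  qed
qed

text \<open>
  The indicator function of \<open>{..<b}\<close> lies between the ramps that descend just before and just after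
  \<open>b\<close>, whose integrals differ from \<open>b\<close> by at most their width.
\<close>

lemma distribution_function_limit:
  assumes b: "0 \<le> b" "b \<le> 1"
  shows "((\<lambda>t. \<Sum>n. w t n * of_bool (y t n < b)) \<longlongrightarrow> \<mu> * b) F"
proof (rule tendstoI)
  fix e :: real
  assume e: "e > 0"
  define d where "d = e / (2 * (\<mu> + 1))"
  have d: "d > 0" "\<mu> * d < e / 2"
    using e limit_nonneg by (auto simp: d_def field_simps)
  have up: "\<forall>\<^sub>F t in F. (\<Sum>n. w t n * ramp (b + d) d (y t n)) < \<mu> * b + e"
    using continuous_average[OF continuous_on_ramp]
  proof (rule order_tendstoD)
    have "\<mu> * integral {0..1} (ramp (b + d) d) \<le> \<mu> * (b + d)"
      using b d by (intro mult_left_mono integral_ramp_le limit_nonneg) auto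
    then show "\<mu> * integral {0..1} (ramp (b + d) d) < \<mu> * b + e"
      using d e by (simp add: algebra_simps)
  qed
  have lo: "\<forall>\<^sub>F t in F. (\<Sum>n. w t n * ramp b d (y t n)) > \<mu> * b - e"
    using continuous_average[OF continuous_on_ramp]
  proof (rule order_tendstoD)
    have "\<mu> * (b - d) \<le> \<mu> * integral {0..1} (ramp b d)"
      using b d by (intro mult_left_mono integral_ramp_ge limit_nonneg) auto
    then show "\<mu> * b - e < \<mu> * integral {0..1} (ramp b d)"
      using d e by (simp add: algebra_simps)
  qed
  show "\<forall>\<^sub>F t in F. dist (\<Sum>n. w t n * of_bool (y t n < b)) (\<mu> * b) < e"
    using up lo weights
  proof eventually_elim
    case (elim t)
    have s: "summable (\<lambda>n. w t n * of_bool (y t n < b))"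
      using elim by (intro weighted_sum_bound(1)[where K=1]) auto
    have sr: "summable (\<lambda>n. w t n * ramp b' d (y t n))" for b'
      using elim d by (intro weighted_sum_bound(1)[where K=1]) (auto simp: ramp_bounds abs_le_iff intro: order_trans[of _ 0])
    have "(\<Sum>n. w t n * of_bool (y t n < b)) \<le> (\<Sum>n. w t n * ramp (b + d) d (y t n))"
      using elim d by (intro suminf_le s sr mult_left_mono) (auto simp: ramp_bounds)
    moreover have "(\<Sum>n. w t n * ramp b d (y t n)) \<le> (\<Sum>n. w t n * of_bool (y t n < b))"
      using elim d by (intro suminf_le s sr mult_left_mono) (auto simp: ramp_bounds)
    ultimately show ?case
      using elim by (auto simp: dist_real_def)
  qed
qed

text \<open>
  Polya's argument: monotone functions that converge pointwise to a continuous limit on a compact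
  interval converge uniformly, because it suffices to compare them on a fine finite grid.
\<close>

lemma distribution_function_uniform_limit:
  assumes e: "e > 0"
  shows "\<forall>\<^sub>F t in F. \<forall>b\<in>{0..1}. \<bar>(\<Sum>n. w t n * of_bool (y t n < b)) - \<mu> * b\<bar> < e"
proof -
  obtain N :: nat where N: "2 * \<mu> / e < real N" "N > 0"
    using reals_Archimedean2[of "max 0 (2 * \<mu> / e)"] by auto
  have gap: "\<mu> / N < e / 2"
    using N e by (simp add: field_simps)
  have "\<forall>\<^sub>F t in F. \<forall>i\<in>{..N}. \<bar>(\<Sum>n. w t n * of_bool (y t n < i / N)) - \<mu> * (i / N)\<bar> < e / 2"
  proof (rule eventually_ball_finite)
    show "\<forall>i\<in>{..N}. \<forall>\<^sub>F t in F. \<bar>(\<Sum>n. w t n * of_bool (y t n < i / N)) - \<mu> * (i / N)\<bar> < e / 2"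
    proof
      fix i assume "i \<in> {..N}"
      then have "((\<lambda>t. \<Sum>n. w t n * of_bool (y t n < real i / N)) \<longlongrightarrow> \<mu> * (real i / N)) F"
        using N by (intro distribution_function_limit) auto
      from tendstoD[OF this, of "e / 2"] e
      show "\<forall>\<^sub>F t in F. \<bar>(\<Sum>n. w t n * of_bool (y t n < i / N)) - \<mu> * (i / N)\<bar> < e / 2"
        by (simp add: dist_real_def)
    qed
  qed simp
  then show ?thesis
    using weights
  proof eventually_elim
    case (elim t)
    show ?case
    proof
      fix b :: real assume b: "b \<in> {0..1}"
      let ?G = "\<lambda>b. \<Sum>n. w t n * of_bool (y t n < b)"
      have mono: "?G b1 \<le> ?G b2" if "b1 \<le> b2" for b1 b2
        using elim that
        by (intro suminf_le weighted_sum_bound(1)[where K=1] mult_left_mono) auto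
      (* b lies in the cell between i/N and j/N; for b = 1 that cell is a point *)
      define i where "i = nat \<lfloor>b * N\<rfloor>"
      define j where "j = nat \<lceil>b * N\<rceil>"
      have bN: "0 \<le> b * N" "b * N \<le> N"
        using b by (auto simp: mult_left_le_one_le)
      have i: "i \<le> N" "real i \<le> b * N" "b * N < real i + 1"
        using bN unfolding i_def by linarith+
      have j: "j \<le> N" "b * N \<le> real j" "real j < b * N + 1"
        using bN unfolding j_def by linarith+
      have ib: "i / N \<le> b" "b \<le> j / N" "b \<le> i / N + 1 / N" "j / N \<le> b + 1 / N"
        using i j N by (auto simp: field_simps)
      have "\<mu> * b \<le> \<mu> * (i / N) + \<mu> / N"
        using mult_left_mono[OF ib(3) limit_nonneg] by (simp add: distrib_left)
      moreover have "\<mu> * (j / N) \<le> \<mu> * b + \<mu> / N"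
        using mult_left_mono[OF ib(4) limit_nonneg] by (simp add: distrib_left)
      moreover have "\<bar>?G (i / N) - \<mu> * (i / N)\<bar> < e / 2" "\<bar>?G (j / N) - \<mu> * (j / N)\<bar> < e / 2"
        using elim i(1) j(1) by auto
      ultimately show "\<bar>?G b - \<mu> * b\<bar> < e"
        using gap mono[OF ib(1)] mono[OF ib(2)] by linarith
    qed
  qed
qed

end

section \<open>From uniform to Lp convergence on bounded intervals\<close>

lemma borel_measurable_step:
  fixes g :: "nat \<Rightarrow> real" and t :: real
  assumes "S \<in> sets lebesgue"
  shows "(\<lambda>x. t * g (nat \<lfloor>t * x\<rfloor> + 1)) \<in> borel_measurable (lebesgue_on S)"
proof -
  have "(\<lambda>x::real. \<lfloor>t * x\<rfloor>) \<in> borel \<rightarrow>\<^sub>M count_space UNIV"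
    by measurable
  then have "(\<lambda>x. t * g (nat \<lfloor>t * x\<rfloor> + 1)) \<in> borel_measurable borel"
    by measurable
  then show ?thesis
    by (intro measurable_restrict_space1 measurable_completion) simp
qed

lemma finite_measure_interval: "finite_measure (lebesgue_on {0<..<M::real})"
  by (intro finite_measureI, cases "0 \<le> M") (simp_all add: emeasure_restrict_space)

lemma bounded_imp_in_Lp:
  assumes meas: "u \<in> borel_measurable (lebesgue_on {0<..<M::real})"
    and bound: "\<And>x. x \<in> {0<..<M} \<Longrightarrow> \<bar>u x\<bar> \<le> K" and "0 \<le> p"
  shows "in_Lp p {0<..<M} u"
proof -
  interpret finite_measure "lebesgue_on {0<..<M::real}" by (rule finite_measure_interval)
  have "integrable (lebesgue_on {0<..<M}) (\<lambda>x. \<bar>u x\<bar> powr p)"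
    using meas bound assms(3)
    by (intro integrable_const_bound[of _ "K powr p"]) (auto intro!: AE_I2 powr_mono2)
  with meas show ?thesis by (simp add: in_Lp_def)
qed

text \<open>
  For \<open>M \<le> 0\<close> the interval is empty; its length is \<open>max 0 M\<close> in all cases.
\<close>

lemma Lp_norm_le:
  assumes meas: "u \<in> borel_measurable (lebesgue_on {0<..<M::real})"
    and bound: "\<And>x. x \<in> {0<..<M} \<Longrightarrow> \<bar>u x\<bar> \<le> K" and "0 \<le> K" "1 \<le> p"
  shows "Lp_norm p {0<..<M} u \<le> K * (max 0 M) powr (1 / p)"
proof -
  interpret finite_measure "lebesgue_on {0<..<M::real}" by (rule finite_measure_interval)
  have "(LINT x|lebesgue_on {0<..<M}. \<bar>u x\<bar> powr p) \<le> (LINT x|lebesgue_on {0<..<M}. K powr p)"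
    using bounded_imp_in_Lp[OF meas bound, of p] assms bound
    by (intro integral_mono) (auto simp: in_Lp_def intro!: powr_mono2)
  also have "\<dots> = K powr p * max 0 M"
    by (simp add: measure_restrict_space mult.commute max_def)
  finally have "Lp_norm p {0<..<M} u \<le> (K powr p * max 0 M) powr (1 / p)"
    unfolding Lp_norm_def using assms by (intro powr_mono2) auto
  also have "\<dots> = K * (max 0 M) powr (1 / p)"
    using assms by (simp add: powr_mult powr_powr)
  finally show ?thesis .
qed

lemma uniformly_small_imp_Lp_norm_small:
  fixes d :: "'t \<Rightarrow> real \<Rightarrow> real \<Rightarrow> real"
  assumes meas: "\<forall>\<^sub>F t in F. \<forall>s\<in>I. d t s \<in> borel_measurable (lebesgue_on {0<..<M})"
    and small: "\<And>e. e > 0 \<Longrightarrow> \<forall>\<^sub>F t in F. \<forall>s\<in>I. \<forall>x\<in>{0<..<M}. \<bar>d t s x\<bar> < e"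
    and p: "1 \<le> p"
  shows "uniform_limit I (\<lambda>t s. Lp_norm p {0<..<M} (d t s)) (\<lambda>s. 0) F"
proof (rule uniform_limitI)
  fix e :: real assume e: "e > 0"
  define C where "C = (max 0 M) powr (1 / p)"
  have C: "C \<ge> 0" by (simp add: C_def)
  define e' where "e' = e / (C + 1)"
  have e': "e' > 0" "e' * C < e"
    using e C by (auto simp: e'_def field_simps)
  show "\<forall>\<^sub>F t in F. \<forall>s\<in>I. dist (Lp_norm p {0<..<M} (d t s)) 0 < e"
    using meas small[OF e'(1)]
  proof eventually_elim
    case (elim t)
    show ?case
    proof
      fix s assume s: "s \<in> I"
      have "Lp_norm p {0<..<M} (d t s) \<le> e' * C"
        unfolding C_def using elim s e' p by (intro Lp_norm_le) (auto intro: less_imp_le)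
      moreover have "0 \<le> Lp_norm p {0<..<M} (d t s)" by (simp add: Lp_norm_def)
      ultimately show "dist (Lp_norm p {0<..<M} (d t s)) 0 < e" using e'(2) by simp
    qed
  qed
qed

lemma uniformly_continuous_imp_in_C_Lp:
  assumes meas: "\<And>s. s \<in> I \<Longrightarrow> u s \<in> borel_measurable (lebesgue_on {0<..<M::real})"
    and bound: "\<And>s. s \<in> I \<Longrightarrow> \<exists>K. \<forall>x\<in>{0<..<M}. \<bar>u s x\<bar> \<le> K"
    and cont: "\<And>s e. s \<in> I \<Longrightarrow> e > 0 \<Longrightarrow> \<forall>\<^sub>F r in at s within I. \<forall>x\<in>{0<..<M}. \<bar>u r x - u s x\<bar> < e"
    and p: "1 \<le> p"
  shows "in_C_Lp I p {0<..<M} u"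
  unfolding in_C_Lp_def
proof (intro conjI ballI)
  fix s assume s: "s \<in> I"
  obtain K where "\<forall>x\<in>{0<..<M}. \<bar>u s x\<bar> \<le> K" using bound[OF s] by blast
  then show "in_Lp p {0<..<M} (u s)"
    using p by (intro bounded_imp_in_Lp[OF meas[OF s], of K]) auto
  have "uniform_limit {s} (\<lambda>r s. Lp_norm p {0<..<M} (\<lambda>x. u r x - u s x)) (\<lambda>s. 0) (at s within I)"
  proof (rule uniformly_small_imp_Lp_norm_small[OF _ _ p])
    have "\<forall>\<^sub>F r in at s within I. r \<in> I"
      by (simp add: eventually_at_filter)
    then show "\<forall>\<^sub>F r in at s within I. \<forall>s\<in>{s}. (\<lambda>x. u r x - u s x) \<in> borel_measurable (lebesgue_on {0<..<M})"
      by eventually_elim (use meas s in auto)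
  qed (use cont[OF s] in auto)
  then show "((\<lambda>r. Lp_norm p {0<..<M} (\<lambda>x. u r x - u s x)) \<longlongrightarrow> 0) (at s within I)"
    by (rule tendsto_uniform_limitI) simp
qed

section \<open>The mass in clusters\<close>

text \<open>
  Controls the deficit \<open>\<Sum>n. c\<^sub>n (1 - z^n)\<close> by the mass \<open>\<Sum>n. n c\<^sub>n\<close>.
\<close>

lemma one_minus_power_le:
  fixes z :: real
  assumes "0 \<le> z" "z \<le> 1"
  shows "1 - z ^ n \<le> real n * (1 - z)"
proof -
  have "1 - z ^ n = (1 - z) * (\<Sum>i<n. z ^ i)"
    by (simp add: sum_gp_strict[of z n] split: if_splits)
  also have "\<dots> \<le> (1 - z) * (\<Sum>i<n. 1)"
    using assms by (intro mult_left_mono sum_mono power_le_one) auto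
  finally show ?thesis by (simp add: mult.commute)
qed

text \<open>
  The hypotheses of the theorem: the total mass exceeds the saturation mass \<open>1 / \<kappa>\<close>, and some of it
  is initially bound in clusters.
\<close>

locale supercritical_solution =
  fixes \<kappa> \<rho> :: real and f :: "real \<Rightarrow> real" and c :: "nat \<Rightarrow> real \<Rightarrow> real"
  assumes kappa_pos: "\<kappa> > 0"
    and solution: "cluster_solution \<kappa> \<rho> f c"
    and supercritical: "\<rho> > 1 / \<kappa>"
    and clusters_present: "f 0 < \<rho>"
begin

definition mass :: "real \<Rightarrow> real" where "mass t = \<rho> - f t"

text \<open>
  The rate at which \<open>mass\<close> grows while it is small: \<open>mass' = (growth - \<kappa> * mass) * mass\<close>.
\<close>

definition growth :: real where "growth = \<kappa> * \<rho> - 1"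

lemma growth_pos: "growth > 0"
  using supercritical kappa_pos by (simp add: growth_def field_simps)

lemma c_nonneg: "t \<ge> 0 \<Longrightarrow> n \<ge> 1 \<Longrightarrow> 0 \<le> c n t"
  using solution by (simp add: cluster_solution_def)

lemma f_nonneg: "t \<ge> 0 \<Longrightarrow> 0 \<le> f t"
  using solution by (simp add: cluster_solution_def)

lemma mass_sums: "t \<ge> 0 \<Longrightarrow> (\<lambda>n. real (Suc n) * c (Suc n) t) sums mass t"
  using solution sums_Suc_iff[of "\<lambda>n. real n * c n t" "mass t"]
  by (simp add: cluster_solution_def mass_def del: of_nat_Suc)

lemma mass_nonneg: "t \<ge> 0 \<Longrightarrow> 0 \<le> mass t"
  using sums_le[OF _ sums_zero mass_sums] c_nonneg by simp

lemma mass_le: "t \<ge> 0 \<Longrightarrow> mass t \<le> \<rho>"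
  using f_nonneg by (simp add: mass_def)

lemma rho_pos: "\<rho> > 0"
  using supercritical kappa_pos by (meson divide_pos_pos less_trans zero_less_one)

lemma weighted_c_le:
  assumes "t \<ge> 0"
  shows "real (Suc n) * c (Suc n) t \<le> \<rho>"
proof -
  have "(\<Sum>i\<in>{n}. real (Suc i) * c (Suc i) t) \<le> (\<Sum>i. real (Suc i) * c (Suc i) t)"
    using mass_sums[OF assms] c_nonneg[OF assms]
    by (intro sum_le_suminf) (auto simp: sums_iff simp del: of_nat_Suc)
  also have "\<dots> = mass t"
    using mass_sums[OF assms] by (simp add: sums_iff)
  finally show ?thesis
    using mass_le[OF assms] by simp
qed

lemma c_le_weighted: "t \<ge> 0 \<Longrightarrow> c (Suc n) t \<le> real (Suc n) * c (Suc n) t"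
  using mult_right_mono[of 1 "real (Suc n)" "c (Suc n) t"] c_nonneg[of t "Suc n"] by simp

lemma c_summable: "t \<ge> 0 \<Longrightarrow> summable (\<lambda>n. c (Suc n) t)"
  using c_nonneg c_le_weighted
  by (intro summable_comparison_test'[OF sums_summable[OF mass_sums[of t]]])
     (simp_all del: of_nat_Suc)

lemma flux_eq: "flux \<kappa> f c n t = \<kappa> * f t * (real n * c n t) - real (Suc n) * c (Suc n) t"
  by (simp add: flux_def)

text \<open>
  The flux is a difference of two multiples of the terms \<open>n c\<^sub>n\<close> of the mass, so the sum over all fluxes
  depends on the clusters through their mass alone.
\<close>

lemma f_derivative:
  assumes "t \<ge> 0"
  shows "(f has_real_derivative (1 - \<kappa> * f t) * mass t) (at t within {0..})"
proof -
  have "(\<lambda>n. real n * c n t) sums mass t"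
    using solution assms by (simp add: cluster_solution_def mass_def)
  then have "(\<lambda>n. flux \<kappa> f c n t) sums (\<kappa> * f t * mass t - mass t)"
    unfolding flux_eq using assms by (intro sums_diff sums_mult mass_sums)
  moreover have "(f has_real_derivative - (\<Sum>n. flux \<kappa> f c n t)) (at t within {0..})"
    using solution assms by (simp add: cluster_solution_def has_C1_derivative_def)
  ultimately show ?thesis
    by (elim DERIV_cong) (simp add: sums_unique[symmetric] algebra_simps)
qed

lemma mass_derivative:
  assumes "t \<ge> 0"
  shows "(mass has_real_derivative (\<kappa> * f t - 1) * mass t) (at t within {0..})"
  unfolding mass_def[abs_def]
  by (rule derivative_eq_intros f_derivative assms refl)+ (simp add: mass_def algebra_simps)

lemma c_derivative:
  assumes "t \<ge> 0"
  shows "(c (Suc n) has_real_derivative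
          (\<kappa> * f t * (real n * c n t) - real (Suc n) * c (Suc n) t
            - \<kappa> * f t * (real (Suc n) * c (Suc n) t) + real (Suc (Suc n)) * c (Suc (Suc n)) t))
         (at t within {0..})"
proof -
  have "\<forall>n\<ge>1. has_C1_derivative (c n) (\<lambda>t. flux \<kappa> f c (n - 1) t - flux \<kappa> f c n t)"
    using solution by (simp add: cluster_solution_def)
  then have "has_C1_derivative (c (Suc n)) (\<lambda>t. flux \<kappa> f c n t - flux \<kappa> f c (Suc n) t)"
    by (metis diff_Suc_1 le_add1 plus_1_eq_Suc)
  then have "(c (Suc n) has_real_derivative flux \<kappa> f c n t - flux \<kappa> f c (Suc n) t) (at t within {0..})"
    using assms by (simp add: has_C1_derivative_def)
  then show ?thesis
    unfolding flux_eq by (rule DERIV_cong) simp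
qed

text \<open>
  The denominator in the explicit solution
  \<open>mass t = growth * mass 0 / logistic_denominator t\<close> of the logistic equation.
\<close>

definition logistic_denominator :: "real \<Rightarrow> real" where
  "logistic_denominator t =
     \<kappa> * mass 0 + (growth - \<kappa> * mass 0) * exp (- (growth * t))"

lemma mass_0_pos: "mass 0 > 0"
  using clusters_present by (simp add: mass_def)

text \<open>
  The difference \<open>D\<close> of the two sides satisfies \<open>D' = - \<kappa> m D\<close> with \<open>\<kappa> m \<ge> 0\<close>, so \<open>D\<^sup>2\<close> cannot increase
  from its initial value \<open>0\<close>.
\<close>

lemma mass_logistic:
  assumes "t \<ge> 0"
  shows "mass t * logistic_denominator t = growth * mass 0"
proof -
  define D where "D s = mass s * logistic_denominator s - growth * mass 0" for s
  have D': "(D has_real_derivative - (\<kappa> * mass s) * D s) (at s within {0..})" if "s \<ge> 0" for s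
    unfolding D_def[abs_def] logistic_denominator_def
    by (rule derivative_eq_intros mass_derivative that refl)+
       (simp add: growth_def mass_def algebra_simps)
  have "(D t)\<^sup>2 \<le> (D 0)\<^sup>2"
  proof (cases "t = 0")
    case False
    have "continuous_on {0..} D"
      using D' by (rule DERIV_continuous_on) auto
    then have cont: "continuous_on {0..t} (\<lambda>s. (D s)\<^sup>2)"
      by (intro continuous_on_power) (auto intro: continuous_on_subset)
    show ?thesis
    proof (rule DERIV_nonpos_imp_decreasing_open[OF assms _ cont])
      fix s assume s: "0 < s" "s < t"
      have "(D has_real_derivative - (\<kappa> * mass s) * D s) (at s within {0<..})"
        by (rule DERIV_subset[OF D']) (use s in auto)
      then have "(D has_real_derivative - (\<kappa> * mass s) * D s) (at s)"
        using s at_within_open[of s "{0<..}"] by simp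
      then have "((\<lambda>s. (D s)\<^sup>2) has_real_derivative 2 * D s * (- (\<kappa> * mass s) * D s)) (at s)"
        by (rule DERIV_power[THEN DERIV_cong]) simp
      moreover have "2 * D s * (- (\<kappa> * mass s) * D s) \<le> 0"
      proof -
        have "0 \<le> 2 * (\<kappa> * mass s) * (D s)\<^sup>2"
          using kappa_pos mass_nonneg[of s] s by (intro mult_nonneg_nonneg) auto
        then show ?thesis by (simp add: power2_eq_square mult_ac)
      qed
      ultimately show "\<exists>y. ((\<lambda>s. (D s)\<^sup>2) has_real_derivative y) (at s) \<and> y \<le> 0"
        by blast
    qed
  qed simp
  also have "D 0 = 0"
    by (simp add: D_def logistic_denominator_def mult.commute)
  finally show ?thesis
    by (simp add: D_def)
qed

lemma mass_pos:
  assumes "t \<ge> 0" shows "mass t > 0"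
  using mass_logistic[OF assms] mass_nonneg[OF assms] growth_pos mass_0_pos
  by (metis less_eq_real_def mult_eq_0_iff less_irrefl mult_pos_pos)

lemma inverse_mass:
  assumes "t \<ge> 0"
  shows "1 / mass t = \<kappa> / growth + (growth - \<kappa> * mass 0) / (growth * mass 0) * exp (- (growth * t))"
proof -
  have "1 / mass t = logistic_denominator t / (growth * mass 0)"
    using mass_logistic[OF assms] mass_pos[OF assms] growth_pos mass_0_pos
    by (simp add: field_simps)
  then show ?thesis
    using growth_pos mass_0_pos
    by (simp add: logistic_denominator_def add_divide_distrib)
qed

text \<open>
  The integral of \<open>1 / mass\<close> over \<open>[0, t]\<close> in closed form.
\<close>

definition inverse_mass_integral :: "real \<Rightarrow> real" where
  "inverse_mass_integral t = \<kappa> / growth * t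
     + (growth - \<kappa> * mass 0) / (growth ^ 2 * mass 0) * (1 - exp (- (growth * t)))"

lemma inverse_mass_integral_0 [simp]: "inverse_mass_integral 0 = 0"
  by (simp add: inverse_mass_integral_def)

lemma inverse_mass_integral_derivative:
  assumes "t \<ge> 0"
  shows "(inverse_mass_integral has_real_derivative 1 / mass t) (at t within S)"
  unfolding inverse_mass[OF assms] inverse_mass_integral_def[abs_def]
  using growth_pos mass_0_pos
  by (auto intro!: derivative_eq_intros simp: power2_eq_square)

lemma inverse_mass_integral_mono:
  assumes "0 \<le> s" "s \<le> t"
  shows "inverse_mass_integral s \<le> inverse_mass_integral t"
  using assms(2)
proof (rule DERIV_nonneg_imp_nondecreasing)
  fix x assume "s \<le> x" "x \<le> t"
  then show "\<exists>y. (inverse_mass_integral has_real_derivative y) (at x) \<and> 0 \<le> y"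
    using assms inverse_mass_integral_derivative[of x] mass_nonneg[of x] by fastforce
qed

section \<open>The generating function along characteristics\<close>

text \<open>
  The sum over \<open>n \<ge> 1\<close> of \<open>c\<^sub>n(t) z^n\<close>; the index is shifted to leave out \<open>c 0\<close>.
\<close>

definition genfun :: "real \<Rightarrow> real \<Rightarrow> real" where
  "genfun t z = (\<Sum>n. c (Suc n) t * z ^ Suc n)"

definition cluster_number :: "real \<Rightarrow> real" where
  "cluster_number t = (\<Sum>n. c (Suc n) t)"

lemma genfun_summable:
  assumes "t \<ge> 0" "0 \<le> z" "z \<le> 1"
  shows "summable (\<lambda>n. c (Suc n) t * z ^ Suc n)"
  using assms c_summable c_nonneg power_le_one[of z]
  by (intro weighted_sum_bound(1)[where K=1]) (auto simp del: power_Suc)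

lemma genfun_near_1:
  assumes "t \<ge> 0" "0 \<le> z" "z \<le> 1"
  shows "\<bar>cluster_number t - genfun t z\<bar> \<le> \<rho> * (1 - z)"
proof -
  have eq: "cluster_number t - genfun t z = (\<Sum>n. c (Suc n) t * (1 - z ^ Suc n))"
    unfolding cluster_number_def genfun_def
    by (subst suminf_diff[OF c_summable genfun_summable]) (use assms in \<open>auto simp: right_diff_distrib\<close>)
  have s: "summable (\<lambda>n. c (Suc n) t * (1 - z ^ Suc n))"
    using summable_diff[OF c_summable genfun_summable[of t z]] assms
    by (simp add: right_diff_distrib)
  have "(\<Sum>n. c (Suc n) t * (1 - z ^ Suc n)) \<le> (\<Sum>n. (real (Suc n) * c (Suc n) t) * (1 - z))"
  proof (intro suminf_le s summable_mult2 sums_summable[OF mass_sums] assms)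
    fix n
    show "c (Suc n) t * (1 - z ^ Suc n) \<le> (real (Suc n) * c (Suc n) t) * (1 - z)"
      using mult_left_mono[OF one_minus_power_le[of z "Suc n"] c_nonneg[of t "Suc n"]] assms
      by (simp add: mult_ac del: of_nat_Suc power_Suc)
  qed
  also have "\<dots> = mass t * (1 - z)"
    using mass_sums[of t] assms by (simp add: sums_iff suminf_mult2[symmetric])
  also have "\<dots> \<le> \<rho> * (1 - z)"
    using assms mass_le by (intro mult_right_mono) auto
  finally have "cluster_number t - genfun t z \<le> \<rho> * (1 - z)"
    by (simp add: eq)
  moreover have "0 \<le> cluster_number t - genfun t z"
    unfolding eq using s assms c_nonneg power_le_one[of z]
    by (intro suminf_nonneg) (auto simp del: power_Suc)
  ultimately show ?thesis by simp
qed

text \<open>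
  On characteristics of the transport equation for \<open>genfun\<close>, \<open>z' = - (1 - z) (1 - \<kappa> f z)\<close>. This
  Riccati equation is linear in \<open>v = z / (1 - z)\<close>, and since \<open>mass' / mass = \<kappa> f - 1\<close> it reads
  \<open>(v / mass)' = - 1 / mass\<close>. The parameter \<open>A\<close> is the value of \<open>v / mass\<close> at the final time \<open>\<tau>\<close>;
  all \<open>A \<ge> 0\<close> give characteristics that stay in \<open>[0, 1)\<close> on \<open>[0, \<tau>]\<close>.
\<close>

definition odds :: "real \<Rightarrow> real \<Rightarrow> real \<Rightarrow> real" where
  "odds \<tau> A t = mass t * (A + inverse_mass_integral \<tau> - inverse_mass_integral t)"

lemma odds_nonneg:
  assumes "0 \<le> t" "t \<le> \<tau>" "A \<ge> 0"
  shows "0 \<le> odds \<tau> A t"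
  unfolding odds_def using assms inverse_mass_integral_mono[of t \<tau>] mass_nonneg[of t]
  by (intro mult_nonneg_nonneg) auto

lemma odds_le:
  assumes "0 \<le> t" "t \<le> \<tau>" "A \<ge> 0"
  shows "odds \<tau> A t \<le> \<rho> * (A + inverse_mass_integral \<tau>)"
  unfolding odds_def
  using assms inverse_mass_integral_mono[of t \<tau>] inverse_mass_integral_mono[of 0 t]
    mass_nonneg[of t] mass_le[of t]
  by (intro mult_mono) auto

lemma odds_derivative:
  assumes "0 \<le> t"
  shows "(odds \<tau> A has_real_derivative (\<kappa> * f t - 1) * odds \<tau> A t - 1) (at t within {0..})"
  unfolding odds_def[abs_def]
  by (rule derivative_eq_intros mass_derivative inverse_mass_integral_derivative assms refl)+
     (use mass_pos[OF assms] in \<open>simp add: algebra_simps\<close>)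

definition characteristic :: "real \<Rightarrow> real \<Rightarrow> real \<Rightarrow> real" where
  "characteristic \<tau> A t = odds \<tau> A t / (1 + odds \<tau> A t)"

lemma characteristic_derivative:
  assumes "0 \<le> t" "t \<le> \<tau>" "A \<ge> 0"
  shows "(characteristic \<tau> A has_real_derivative
     - ((1 - characteristic \<tau> A t) * (1 - \<kappa> * f t * characteristic \<tau> A t))) (at t within {0..})"
proof -
  define v where "v = odds \<tau> A t"
  have v: "1 + v > 0" using odds_nonneg[OF assms] by (simp add: v_def)
  have "(characteristic \<tau> A has_real_derivative ((\<kappa> * f t - 1) * v - 1) / (1 + v)\<^sup>2) (at t within {0..})"
    unfolding characteristic_def[abs_def]
    by (rule derivative_eq_intros odds_derivative assms refl)+
       (use v in \<open>auto simp: v_def power2_eq_square algebra_simps\<close>)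
  moreover have "((\<kappa> * f t - 1) * v - 1) / (1 + v)\<^sup>2 =
     - ((1 - v / (1 + v)) * (1 - \<kappa> * f t * (v / (1 + v))))"
  proof -
    have e: "1 - v / (1 + v) = 1 / (1 + v)"
      "1 - \<kappa> * f t * (v / (1 + v)) = (1 + v - \<kappa> * f t * v) / (1 + v)"
      using v by (simp_all add: field_simps)
    show ?thesis
      unfolding e times_divide_times_eq minus_divide_left
      by (rule arg_cong2[where f="(/)"]) (simp_all add: power2_eq_square algebra_simps)
  qed
  ultimately show ?thesis
    by (simp add: characteristic_def v_def)
qed

lemma characteristic_bounds:
  assumes "0 \<le> t" "t \<le> \<tau>" "A \<ge> 0"
  shows "0 \<le> characteristic \<tau> A t"
    and "characteristic \<tau> A t \<le> 1 - 1 / (1 + \<rho> * (A + inverse_mass_integral \<tau>))"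
proof -
  have v: "0 \<le> odds \<tau> A t" "odds \<tau> A t \<le> \<rho> * (A + inverse_mass_integral \<tau>)"
    using odds_nonneg[OF assms] odds_le[OF assms] by auto
  show "0 \<le> characteristic \<tau> A t"
    using v by (simp add: characteristic_def)
  have "characteristic \<tau> A t = 1 - 1 / (1 + odds \<tau> A t)"
    using v by (simp add: characteristic_def field_simps)
  also have "\<dots> \<le> 1 - 1 / (1 + \<rho> * (A + inverse_mass_integral \<tau>))"
    using v by (intro diff_left_mono divide_left_mono) auto
  finally show "characteristic \<tau> A t \<le> 1 - 1 / (1 + \<rho> * (A + inverse_mass_integral \<tau>))" .
qed

text \<open>
  With \<open>S = \<Sum>n\<ge>1. n c\<^sub>n z^(n - 1)\<close>, the equations for \<open>c\<^sub>n\<close> contribute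
  \<open>- c\<^sub>1 + (1 - z) (1 - \<kappa> f z) S\<close> to the derivative and the motion of \<open>z\<close> contributes \<open>z' S\<close>; the
  multiples of \<open>S\<close> cancel. The series may be differentiated termwise since \<open>z\<close> stays below some
  \<open>r < 1\<close> on \<open>[0, \<tau>]\<close> and \<open>n c\<^sub>n \<le> \<rho>\<close>, which gives a geometric majorant.
\<close>

lemma genfun_along_characteristic:
  assumes "0 \<le> t" "t \<le> \<tau>" "A \<ge> 0"
  shows "((\<lambda>s. genfun s (characteristic \<tau> A s)) has_real_derivative - c 1 t) (at t within {0..\<tau>})"
proof -
  define \<zeta> where "\<zeta> = characteristic \<tau> A"
  define \<zeta>' where "\<zeta>' s = - ((1 - \<zeta> s) * (1 - \<kappa> * f s * \<zeta> s))" for s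
  define r where "r = 1 - 1 / (1 + \<rho> * (A + inverse_mass_integral \<tau>))"
  define c' where "c' n s = \<kappa> * f s * (real n * c n s) - real (Suc n) * c (Suc n) s
            - \<kappa> * f s * (real (Suc n) * c (Suc n) s) + real (Suc (Suc n)) * c (Suc (Suc n)) s" for n s
  define D where "D n s = c' n s * \<zeta> s ^ Suc n + c (Suc n) s * (real (Suc n) * \<zeta> s ^ n * \<zeta>' s)" for n s
  have inverse_mass_integral: "0 \<le> inverse_mass_integral \<tau>" using inverse_mass_integral_mono[of 0 \<tau>] assms by simp
  have "0 \<le> \<rho> * (A + inverse_mass_integral \<tau>)" using inverse_mass_integral rho_pos assms by simp
  then have r: "0 \<le> r" "r < 1" by (auto simp: r_def)
  have \<zeta>: "0 \<le> \<zeta> s" "\<zeta> s \<le> r" if "s \<in> {0..\<tau>}" for s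
    using characteristic_bounds[of s \<tau> A] that assms by (auto simp: \<zeta>_def r_def)
  have D: "((\<lambda>s. c (Suc n) s * \<zeta> s ^ Suc n) has_real_derivative D n s) (at s within {0..\<tau>})"
    if s: "s \<in> {0..\<tau>}" for n s
  proof -
    have 1: "(c (Suc n) has_real_derivative c' n s) (at s within {0..\<tau>})"
      unfolding c'_def by (rule DERIV_subset[OF c_derivative]) (use s in auto)
    have 2: "(\<zeta> has_real_derivative \<zeta>' s) (at s within {0..\<tau>})"
      unfolding \<zeta>'_def \<zeta>_def by (rule DERIV_subset[OF characteristic_derivative]) (use s assms in auto)
    show ?thesis
      unfolding D_def
      by (rule derivative_eq_intros 1 2 refl)+ (simp add: algebra_simps)
  qed
  have f_le: "0 \<le> \<kappa> * f s" "\<kappa> * f s \<le> \<kappa> * \<rho>" if "s \<in> {0..\<tau>}" for s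
    using that kappa_pos f_nonneg[of s] mass_nonneg[of s] by (auto simp: mass_def)
  \<comment> \<open>The four terms of \<open>c'\<close> are bounded by \<open>\<kappa> \<rho>\<^sup>2\<close> or \<open>\<rho>\<close>, and \<open>\<bar>\<zeta>'\<bar> \<le> 1 + \<kappa> \<rho>\<close>.\<close>
  define K where "K = 2 * (\<kappa> * \<rho> * \<rho>) + 2 * \<rho> + \<rho> * (1 + \<kappa> * \<rho>)"
  have bound: "norm (D n s) \<le> K * r ^ n" if s: "s \<in> {0..\<tau>}" for n s
  proof -
    have w: "0 \<le> real n * c n s" "real n * c n s \<le> \<rho>" for n
      using weighted_c_le[of s "n - 1"] c_nonneg[of s n] s rho_pos by (cases n; simp)+
    have w2: "0 \<le> \<kappa> * f s * (real n * c n s)" "\<kappa> * f s * (real n * c n s) \<le> \<kappa> * \<rho> * \<rho>" for n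
      using w[of n] f_le[OF s] kappa_pos rho_pos by (auto intro!: mult_mono)
    have "\<bar>c' n s\<bar> \<le> 2 * (\<kappa> * \<rho> * \<rho>) + 2 * \<rho>"
      unfolding c'_def using w[of "Suc n"] w[of "Suc (Suc n)"] w2[of n] w2[of "Suc n"] by linarith
    moreover have p: "0 \<le> \<zeta> s ^ Suc n" "\<zeta> s ^ Suc n \<le> r ^ n" "0 \<le> \<zeta> s ^ n" "\<zeta> s ^ n \<le> r ^ n"
    proof -
      show "0 \<le> \<zeta> s ^ Suc n" "0 \<le> \<zeta> s ^ n" "\<zeta> s ^ n \<le> r ^ n"
        using \<zeta>[OF s] by (auto intro: power_mono)
      have "\<zeta> s * \<zeta> s ^ n \<le> 1 * r ^ n"
        using \<zeta>[OF s] r by (intro mult_mono power_mono) auto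
      then show "\<zeta> s ^ Suc n \<le> r ^ n" by simp
    qed
    ultimately have 1: "\<bar>c' n s * \<zeta> s ^ Suc n\<bar> \<le> (2 * (\<kappa> * \<rho> * \<rho>) + 2 * \<rho>) * r ^ n"
      unfolding abs_mult by (intro mult_mono) (use p in \<open>auto intro: order_trans[OF abs_ge_zero]\<close>)
    have z1: "\<kappa> * f s * \<zeta> s \<le> \<kappa> * \<rho> * 1" "0 \<le> \<kappa> * f s * \<zeta> s"
      using mult_mono[OF f_le(2)[OF s], of "\<zeta> s" 1] mult_nonneg_nonneg[OF f_le(1)[OF s] \<zeta>(1)[OF s]]
        \<zeta>[OF s] r kappa_pos rho_pos by auto
    have "\<bar>\<zeta>' s\<bar> \<le> 1 * (1 + \<kappa> * \<rho>)"
      unfolding \<zeta>'_def abs_minus_cancel abs_mult using \<zeta>[OF s] z1 r by (intro mult_mono) auto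
    then have "(real (Suc n) * c (Suc n) s) * \<zeta> s ^ n * \<bar>\<zeta>' s\<bar> \<le> \<rho> * r ^ n * (1 * (1 + \<kappa> * \<rho>))"
      using w[of "Suc n"] p r rho_pos by (intro mult_mono) (auto simp del: of_nat_Suc)
    moreover have "\<bar>c (Suc n) s * (real (Suc n) * \<zeta> s ^ n * \<zeta>' s)\<bar> =
        (real (Suc n) * c (Suc n) s) * \<zeta> s ^ n * \<bar>\<zeta>' s\<bar>"
      using w[of "Suc n"] p c_nonneg[of s "Suc n"] s by (simp add: abs_mult mult_ac del: of_nat_Suc)
    ultimately have 2: "\<bar>c (Suc n) s * (real (Suc n) * \<zeta> s ^ n * \<zeta>' s)\<bar> \<le> \<rho> * (1 + \<kappa> * \<rho>) * r ^ n"
      by (simp add: mult_ac)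
    have "norm (D n s) \<le> (2 * (\<kappa> * \<rho> * \<rho>) + 2 * \<rho>) * r ^ n + \<rho> * (1 + \<kappa> * \<rho>) * r ^ n"
      unfolding D_def real_norm_def using abs_triangle_ineq add_mono[OF 1 2] by (rule order_trans)
    then show ?thesis by (simp add: K_def algebra_simps)
  qed
  have unif: "uniform_limit {0..\<tau>} (\<lambda>n s. \<Sum>i<n. D i s) (\<lambda>s. \<Sum>n. D n s) sequentially"
    by (rule Weierstrass_m_test[where M="\<lambda>n. K * r ^ n"])
       (use bound r in \<open>auto intro!: summable_mult summable_geometric\<close>)
  have "\<exists>g. \<forall>s\<in>{0..\<tau>}. (\<lambda>n. c (Suc n) s * \<zeta> s ^ Suc n) sums g s \<and>
      (g has_real_derivative (\<Sum>n. D n s)) (at s within {0..\<tau>})"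
    using D unif
  proof (rule has_field_derivative_series[OF convex_real_interval(5)])
    show "t \<in> {0..\<tau>}" using assms by simp
    then show "summable (\<lambda>n. c (Suc n) t * \<zeta> t ^ Suc n)"
      using \<zeta>[of t] r assms by (intro genfun_summable) auto
  qed auto
  then obtain g where g: "\<And>s. s \<in> {0..\<tau>} \<Longrightarrow> (\<lambda>n. c (Suc n) s * \<zeta> s ^ Suc n) sums g s"
    "\<And>s. s \<in> {0..\<tau>} \<Longrightarrow> (g has_real_derivative (\<Sum>n. D n s)) (at s within {0..\<tau>})"
    by blast
  have t: "t \<in> {0..\<tau>}" using assms by simp
  have gf: "genfun s (characteristic \<tau> A s) = g s" if "s \<in> {0..\<tau>}" for s
    using g(1)[OF that] by (simp add: genfun_def \<zeta>_def sums_iff)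
  have "((\<lambda>s. genfun s (characteristic \<tau> A s)) has_real_derivative (\<Sum>n. D n t)) (at t within {0..\<tau>})"
    using has_field_derivative_transform_within[OF g(2)[OF t], of 1] gf t by auto
  moreover have "(\<lambda>n. D n t) sums - c 1 t"
  proof -
    define z where "z = \<zeta> t"
    define a where "a n = real (Suc n) * c (Suc n) t * z ^ n" for n
    define S where "S = (\<Sum>n. a n)"
    have z: "0 \<le> z" "z \<le> 1" using \<zeta>[OF t] r by (auto simp: z_def)
    have "summable a"
      unfolding a_def
      by (rule weighted_sum_bound(1)[where K=1])
         (use sums_summable[OF mass_sums] c_nonneg z assms in \<open>auto intro: power_le_one simp del: of_nat_Suc\<close>)
    then have S: "a sums S" unfolding S_def by (rule summable_sums)
    \<comment> \<open>The same series with its vanishing term of index \<open>0\<close>, as it arises from the flux into size \<open>n + 1\<close>.\<close>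
    have S0: "(\<lambda>n. real n * c n t * z ^ (n - 1)) sums S"
      using S sums_Suc_iff[of "\<lambda>n. real n * c n t * z ^ (n - 1)" S] by (simp add: a_def[abs_def] del: of_nat_Suc)
    have S2: "(\<lambda>n. a (Suc n)) sums (S - c 1 t)"
      using S sums_Suc_iff[of a "S - c 1 t"] by (simp add: a_def)
    have D_eq: "D n t = \<kappa> * f t * z\<^sup>2 * (real n * c n t * z ^ (n - 1)) - (1 + \<kappa> * f t) * z * a n
        + a (Suc n) + \<zeta>' t * a n" for n
      by (cases n) (simp_all add: D_def c'_def a_def z_def[symmetric] power2_eq_square algebra_simps)
    have "(\<lambda>n. D n t) sums (\<kappa> * f t * z\<^sup>2 * S - (1 + \<kappa> * f t) * z * S + (S - c 1 t) + \<zeta>' t * S)"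
      unfolding D_eq by (intro sums_add sums_diff sums_mult S0 S S2)
    also have "\<kappa> * f t * z\<^sup>2 * S - (1 + \<kappa> * f t) * z * S + (S - c 1 t) + \<zeta>' t * S = - c 1 t"
      by (simp add: \<zeta>'_def z_def[symmetric] power2_eq_square algebra_simps)
    finally show ?thesis .
  qed
  ultimately show ?thesis
    by (simp add: sums_iff)
qed

text \<open>
  The loss term \<open>- c 1\<close> does not depend on the characteristic.
\<close>

lemma genfun_difference_conserved:
  assumes "0 \<le> \<tau>" "A \<ge> 0" "B \<ge> 0"
  shows "genfun \<tau> (characteristic \<tau> B \<tau>) - genfun \<tau> (characteristic \<tau> A \<tau>) =
    genfun 0 (characteristic \<tau> B 0) - genfun 0 (characteristic \<tau> A 0)"
proof -
  have "\<exists>k. \<forall>t\<in>{0..\<tau>}. genfun t (characteristic \<tau> B t) - genfun t (characteristic \<tau> A t) = k"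
  proof (rule has_field_derivative_zero_constant)
    fix t assume "t \<in> {0..\<tau>}"
    then have "((\<lambda>t. genfun t (characteristic \<tau> B t) - genfun t (characteristic \<tau> A t))
        has_real_derivative (- c 1 t - - c 1 t)) (at t within {0..\<tau>})"
      using assms by (intro DERIV_diff genfun_along_characteristic) auto
    then show "((\<lambda>t. genfun t (characteristic \<tau> B t) - genfun t (characteristic \<tau> A t))
        has_real_derivative 0) (at t within {0..\<tau>})"
      by simp
  qed simp
  then show ?thesis using assms by auto
qed

lemma characteristic_tendsto_1:
  assumes "0 \<le> t"
  shows "((\<lambda>B. characteristic \<tau> B t) \<longlongrightarrow> 1) at_top"
proof -
  have m: "mass t > 0" using mass_pos[OF assms] .
  have "filterlim (\<lambda>B. odds \<tau> B t) at_top at_top"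
    unfolding odds_def
    by (intro filterlim_tendsto_pos_mult_at_top[OF tendsto_const m])
       (use filterlim_tendsto_add_at_top[OF tendsto_const filterlim_ident,
          of "inverse_mass_integral \<tau> - inverse_mass_integral t"] in \<open>simp add: algebra_simps\<close>)
  moreover have "((\<lambda>v::real. v / (1 + v)) \<longlongrightarrow> 1) at_top"
    by real_asymp
  ultimately show ?thesis
    unfolding characteristic_def by (rule filterlim_compose[rotated])
qed

lemma genfun_tendsto_cluster_number:
  assumes "0 \<le> t" "t \<le> \<tau>"
  shows "((\<lambda>B. genfun t (characteristic \<tau> B t)) \<longlongrightarrow> cluster_number t) at_top"
proof -
  have "((\<lambda>B. genfun t (characteristic \<tau> B t) - cluster_number t) \<longlongrightarrow> 0) at_top"
  proof (rule Lim_null_comparison)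
    show "((\<lambda>B. \<rho> * (1 - characteristic \<tau> B t)) \<longlongrightarrow> 0) at_top"
      using tendsto_mult[OF tendsto_const
          tendsto_diff[OF tendsto_const characteristic_tendsto_1[OF assms(1)]], of \<rho> 1 \<tau>]
      by simp
    show "\<forall>\<^sub>F B in at_top. norm (genfun t (characteristic \<tau> B t) - cluster_number t) \<le> \<rho> * (1 - characteristic \<tau> B t)"
      using eventually_ge_at_top[of 0]
    proof eventually_elim
      case (elim B)
      have "0 \<le> odds \<tau> B t" by (rule odds_nonneg) (use assms elim in auto)
      then have "0 \<le> characteristic \<tau> B t" "characteristic \<tau> B t \<le> 1"
        by (auto simp: characteristic_def)
      from genfun_near_1[OF assms(1) this] show ?case by (simp add: abs_minus_commute)
    qed
  qed
  then show ?thesis by (rule LIM_zero_cancel)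
qed

text \<open>
  A characteristic with \<open>B \<longlongrightarrow> \<infinity>\<close> tends to the fixed point \<open>1\<close> of the characteristic equation, where
  the generating function is the number of clusters. Passing to the limit in the difference of two
  characteristics avoids differentiating termwise at \<open>z = 1\<close>, where the geometric majorant is lost.
\<close>

lemma deficit_conserved:
  assumes "0 \<le> \<tau>" "A \<ge> 0"
  shows "cluster_number \<tau> - genfun \<tau> (characteristic \<tau> A \<tau>) = cluster_number 0 - genfun 0 (characteristic \<tau> A 0)"
proof (rule tendsto_unique)
  show "((\<lambda>B. genfun \<tau> (characteristic \<tau> B \<tau>) - genfun \<tau> (characteristic \<tau> A \<tau>)) \<longlongrightarrow>
      cluster_number \<tau> - genfun \<tau> (characteristic \<tau> A \<tau>)) at_top"
    using assms by (intro tendsto_intros genfun_tendsto_cluster_number) auto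
  have "((\<lambda>B. genfun 0 (characteristic \<tau> B 0) - genfun 0 (characteristic \<tau> A 0)) \<longlongrightarrow>
      cluster_number 0 - genfun 0 (characteristic \<tau> A 0)) at_top"
    using assms by (intro tendsto_intros genfun_tendsto_cluster_number) auto
  then show "((\<lambda>B. genfun \<tau> (characteristic \<tau> B \<tau>) - genfun \<tau> (characteristic \<tau> A \<tau>)) \<longlongrightarrow>
      cluster_number 0 - genfun 0 (characteristic \<tau> A 0)) at_top"
    by (rule Lim_transform_eventually)
       (use eventually_ge_at_top[of 0] in \<open>eventually_elim, use assms genfun_difference_conserved in auto\<close>)
qed simp

section \<open>Long-time limit of the scaled cluster distribution\<close>

definition limit_mass :: real where "limit_mass = \<rho> - 1 / \<kappa>"

lemma limit_mass_pos: "limit_mass > 0"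
  using supercritical by (simp add: limit_mass_def)

lemma limit_mass_eq: "1 / limit_mass = \<kappa> / growth"
  using kappa_pos growth_pos by (simp add: limit_mass_def growth_def field_simps)

lemma exp_growth_limit: "((\<lambda>t. exp (- (growth * t))) \<longlongrightarrow> 0) at_top"
  using growth_pos by real_asymp

lemma inverse_mass_limit: "((\<lambda>t. 1 / mass t) \<longlongrightarrow> 1 / limit_mass) at_top"
proof -
  have "((\<lambda>t. \<kappa> / growth + (growth - \<kappa> * mass 0) / (growth * mass 0) * exp (- (growth * t)))
      \<longlongrightarrow> \<kappa> / growth + (growth - \<kappa> * mass 0) / (growth * mass 0) * 0) at_top"
    by (intro tendsto_add tendsto_mult tendsto_const exp_growth_limit)
  then show ?thesis
    unfolding limit_mass_eq mult_zero_right add_0_right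
    by (rule Lim_transform_eventually)
       (use eventually_ge_at_top[of 0] in \<open>eventually_elim, simp add: inverse_mass\<close>)
qed

lemma inverse_mass_integral_limit: "((\<lambda>t. inverse_mass_integral t / t) \<longlongrightarrow> 1 / limit_mass) at_top"
proof -
  define K where "K = (growth - \<kappa> * mass 0) / (growth ^ 2 * mass 0)"
  have "((\<lambda>t::real. 1 / t) \<longlongrightarrow> 0) at_top"
    by real_asymp
  then have "((\<lambda>t. \<kappa> / growth + K * (1 - exp (- (growth * t))) * (1 / t))
      \<longlongrightarrow> \<kappa> / growth + K * (1 - 0) * 0) at_top"
    by (intro tendsto_add tendsto_mult tendsto_diff tendsto_const exp_growth_limit)
  then show ?thesis
    unfolding limit_mass_eq mult_zero_right add_0_right
    by (rule Lim_transform_eventually)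
       (use eventually_gt_at_top[of 0] in
        \<open>eventually_elim, simp add: inverse_mass_integral_def K_def[symmetric] add_divide_distrib\<close>)
qed

text \<open>
  The derivative of the initial generating function at its boundary point \<open>1\<close> is the initial mass:
  \<open>(1 - z^n) / (1 - z) = \<Sum>i<n. z^i\<close> is bounded by its limit \<open>n\<close>, so the limit may be taken termwise
  by Tannery's theorem.
\<close>

lemma initial_slope:
  fixes \<zeta> :: "'t \<Rightarrow> real"
  assumes lim: "(\<zeta> \<longlongrightarrow> 1) F" and ev: "\<forall>\<^sub>F t in F. 0 \<le> \<zeta> t \<and> \<zeta> t < 1" and F: "F \<noteq> bot"
  shows "((\<lambda>t. (cluster_number 0 - genfun 0 (\<zeta> t)) / (1 - \<zeta> t)) \<longlongrightarrow> mass 0) F"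
proof -
  define a where "a n t = c (Suc n) 0 * (\<Sum>i<Suc n. \<zeta> t ^ i)" for n t
  have "((\<lambda>t. \<Sum>n. a n t) \<longlongrightarrow> (\<Sum>n. real (Suc n) * c (Suc n) 0)) F"
  proof (rule tannerys_theorem[THEN conjunct2, THEN conjunct2])
    fix n
    have "(a n \<longlongrightarrow> c (Suc n) 0 * (\<Sum>i<Suc n. 1 ^ i)) F"
      unfolding a_def[abs_def] by (intro tendsto_intros lim)
    then show "(a n \<longlongrightarrow> real (Suc n) * c (Suc n) 0) F"
      by (simp add: mult.commute)
  next
    have "\<forall>\<^sub>F x in at_top \<times>\<^sub>F F. True \<and> (0 \<le> \<zeta> (snd x) \<and> \<zeta> (snd x) < 1)"
      by (rule eventually_prodI[OF eventually_True ev])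
    then show "\<forall>\<^sub>F (n, t) in at_top \<times>\<^sub>F F. norm (a n t) \<le> real (Suc n) * c (Suc n) 0"
    proof eventually_elim
      case (elim x)
      obtain n t where x: "x = (n, t)" by force
      have "(\<Sum>i<Suc n. \<zeta> t ^ i) \<le> (\<Sum>i<Suc n. 1)"
        using elim x by (intro sum_mono power_le_one) auto
      moreover have "0 \<le> (\<Sum>i<Suc n. \<zeta> t ^ i)"
        using elim x by (intro sum_nonneg) auto
      ultimately show ?case
        using c_nonneg[of 0 "Suc n"] mult_left_mono[of "\<Sum>i<Suc n. \<zeta> t ^ i" "real (Suc n)" "c (Suc n) 0"]
        by (simp add: x a_def abs_mult mult.commute del: sum.lessThan_Suc)
    qed
    show "summable (\<lambda>n. real (Suc n) * c (Suc n) 0)"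
      using mass_sums[of 0] by (simp add: sums_iff)
  qed (rule F)
  also have "(\<Sum>n. real (Suc n) * c (Suc n) 0) = mass 0"
    using mass_sums[of 0] by (simp add: sums_iff)
  finally show ?thesis
  proof (rule Lim_transform_eventually)
    show "\<forall>\<^sub>F t in F. (\<Sum>n. a n t) = (cluster_number 0 - genfun 0 (\<zeta> t)) / (1 - \<zeta> t)"
      using ev
    proof eventually_elim
      case (elim t)
      have g: "summable (\<lambda>n. c (Suc n) 0 * \<zeta> t ^ Suc n)"
        using elim by (intro genfun_summable) auto
      have "cluster_number 0 - genfun 0 (\<zeta> t) = (\<Sum>n. c (Suc n) 0 - c (Suc n) 0 * \<zeta> t ^ Suc n)"
        unfolding cluster_number_def genfun_def by (intro suminf_diff c_summable g) simp
      then have "(cluster_number 0 - genfun 0 (\<zeta> t)) / (1 - \<zeta> t) =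
          (\<Sum>n. (c (Suc n) 0 - c (Suc n) 0 * \<zeta> t ^ Suc n) / (1 - \<zeta> t))"
        using suminf_divide[OF summable_diff[OF c_summable[of 0] g]] by simp
      also have "\<dots> = (\<Sum>n. a n t)"
      proof (rule suminf_cong)
        fix n
        have "(\<Sum>i<Suc n. \<zeta> t ^ i) = (1 - \<zeta> t ^ Suc n) / (1 - \<zeta> t)"
          using elim by (subst sum_gp_strict) auto
        then show "(c (Suc n) 0 - c (Suc n) 0 * \<zeta> t ^ Suc n) / (1 - \<zeta> t) = a n t"
          by (simp add: a_def right_diff_distrib del: sum.lessThan_Suc power_Suc)
      qed
      finally show ?case by simp
    qed
  qed
qed

text \<open>
  By \<open>deficit_conserved\<close> the deficit at \<open>(t, z t)\<close> is the initial deficit at the starting point \<open>\<zeta> t\<close> of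
  the characteristic. Here \<open>1 - \<zeta> t\<close> is asymptotic to \<open>limit_mass / ((L + 1) * mass 0 * t)\<close>, and by
  \<open>initial_slope\<close> the initial deficit is asymptotic to \<open>mass 0 * (1 - \<zeta> t)\<close>, so the initial mass
  cancels.
\<close>

lemma deficit_limit:
  assumes ev: "\<forall>\<^sub>F t in at_top. 0 \<le> z t \<and> z t < 1"
    and lim: "((\<lambda>t. z t / (1 - z t) / t) \<longlongrightarrow> L) at_top" and "L \<ge> 0"
  shows "((\<lambda>t. t * (cluster_number t - genfun t (z t))) \<longlongrightarrow> limit_mass / (L + 1)) at_top"
proof -
  \<comment> \<open>This choice makes the characteristic end at \<open>z t\<close>.\<close>
  define A where "A t = z t / (1 - z t) / mass t" for t
  define \<zeta> where "\<zeta> t = characteristic t (A t) 0" for t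
  define l where "l = mass 0 * (L * (1 / limit_mass) + 1 / limit_mass)"
  have l: "l > 0"
    using limit_mass_pos mass_0_pos \<open>L \<ge> 0\<close> by (auto simp: l_def intro!: mult_pos_pos add_nonneg_pos)
  have inv: "((\<lambda>t::real. 1 / t) \<longlongrightarrow> 0) at_top"
    by real_asymp
  have "((\<lambda>t. 1 / (1 / t + mass 0 * (z t / (1 - z t) / t * (1 / mass t) + inverse_mass_integral t / t)))
      \<longlongrightarrow> 1 / (0 + l)) at_top"
    unfolding l_def
    by (rule tendsto_divide[OF tendsto_const tendsto_add[OF inv tendsto_mult[OF tendsto_const
          tendsto_add[OF tendsto_mult[OF lim inverse_mass_limit] inverse_mass_integral_limit]]]])
       (use l[unfolded l_def] in linarith)
  moreover have nice: "\<forall>\<^sub>F t in at_top. 0 < t \<and> 0 \<le> z t \<and> z t < 1 \<and> 0 \<le> A t \<and> 0 \<le> \<zeta> t \<and> \<zeta> t < 1 \<and>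
      1 / (1 / t + mass 0 * (z t / (1 - z t) / t * (1 / mass t) + inverse_mass_integral t / t)) = t * (1 - \<zeta> t) \<and>
      characteristic t (A t) t = z t"
    using ev eventually_gt_at_top[of 0]
  proof eventually_elim
    case (elim t)
    have m: "mass t > 0" using mass_pos[of t] elim by simp
    have A: "A t \<ge> 0" using elim m by (simp add: A_def)
    have v: "0 \<le> odds t (A t) 0" using A elim by (intro odds_nonneg) auto
    have z: "0 \<le> \<zeta> t" "\<zeta> t < 1" "1 - \<zeta> t = 1 / (1 + odds t (A t) 0)"
      using v by (simp_all add: \<zeta>_def characteristic_def field_simps)
    have "1 / t + mass 0 * (z t / (1 - z t) / t * (1 / mass t) + inverse_mass_integral t / t) = (1 + odds t (A t) 0) / t"
      by (simp add: odds_def A_def add_divide_distrib distrib_left mult_ac)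
    then have e: "1 / (1 / t + mass 0 * (z t / (1 - z t) / t * (1 / mass t) + inverse_mass_integral t / t)) = t * (1 - \<zeta> t)"
      using z(3) by simp
    have "odds t (A t) t = z t / (1 - z t)"
      using m by (simp add: odds_def A_def)
    moreover have "1 + z t / (1 - z t) = 1 / (1 - z t)"
      using elim by (simp add: field_simps)
    ultimately have "characteristic t (A t) t = z t"
      using elim by (simp add: characteristic_def)
    with e z A elim show ?case by simp
  qed
  ultimately have 1: "((\<lambda>t. t * (1 - \<zeta> t)) \<longlongrightarrow> 1 / l) at_top"
    by (simp, elim Lim_transform_eventually) (auto elim: eventually_mono)
  have "((\<lambda>t. 1 - 1 / t * (t * (1 - \<zeta> t))) \<longlongrightarrow> 1 - 0 * (1 / l)) at_top"
    by (intro tendsto_diff[OF tendsto_const tendsto_mult[OF inv 1]])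
  then have "((\<lambda>t. 1 - 1 / t * (t * (1 - \<zeta> t))) \<longlongrightarrow> 1) at_top" by simp
  then have "(\<zeta> \<longlongrightarrow> 1) at_top"
    by (rule Lim_transform_eventually) (use nice in \<open>eventually_elim, simp\<close>)
  then have 2: "((\<lambda>t. (cluster_number 0 - genfun 0 (\<zeta> t)) / (1 - \<zeta> t)) \<longlongrightarrow> mass 0) at_top"
    by (rule initial_slope) (use nice in \<open>auto elim!: eventually_mono\<close>)
  have "((\<lambda>t. t * (1 - \<zeta> t) * ((cluster_number 0 - genfun 0 (\<zeta> t)) / (1 - \<zeta> t))) \<longlongrightarrow> 1 / l * mass 0) at_top"
    by (rule tendsto_mult[OF 1 2])
  also have "1 / l * mass 0 = limit_mass / (L + 1)"
  proof -
    have "l = mass 0 * ((L + 1) / limit_mass)"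
      by (simp add: l_def add_divide_distrib)
    then show ?thesis
      using mass_0_pos by simp
  qed
  finally show ?thesis
  proof (rule Lim_transform_eventually)
    show "\<forall>\<^sub>F t in at_top. t * (1 - \<zeta> t) * ((cluster_number 0 - genfun 0 (\<zeta> t)) / (1 - \<zeta> t)) =
        t * (cluster_number t - genfun t (z t))"
      using nice
    proof eventually_elim
      case (elim t)
      then have "cluster_number t - genfun t (z t) = cluster_number 0 - genfun 0 (\<zeta> t)"
        using deficit_conserved[of t "A t"] by (simp add: \<zeta>_def)
      then show ?case using elim by simp
    qed
  qed
qed

lemma cluster_number_limit: "((\<lambda>t. t * cluster_number t) \<longlongrightarrow> limit_mass) at_top"
  using deficit_limit[of "\<lambda>t. 0" 0] by (simp add: genfun_def)

text \<open>
  The odds of \<open>exp (- q / t)\<close> are asymptotic to \<open>t / q\<close>. The case \<open>q = 0\<close>, in which the point is \<open>1\<close>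
  and the deficit vanishes, is the limit of the number of clusters.
\<close>

lemma moment_limit: "((\<lambda>t. t * genfun t (exp (- (real q / t)))) \<longlongrightarrow> limit_mass / (real q + 1)) at_top"
proof (cases "q = 0")
  case True
  then show ?thesis using cluster_number_limit by (simp add: genfun_def cluster_number_def)
next
  case False
  then have q: "real q > 0" by simp
  define Q where "Q = real q"
  have Q: "Q > 0" using q by (simp add: Q_def)
  have "((\<lambda>t. exp (- (Q / t)) / (1 - exp (- (Q / t))) / t) \<longlongrightarrow> inverse Q) at_top"
    using Q by real_asymp
  moreover have "\<forall>\<^sub>F t in at_top. 0 \<le> exp (- (Q / t)) \<and> exp (- (Q / t)) < 1"
    using eventually_gt_at_top[of 0] by eventually_elim (use Q in auto)
  ultimately have "((\<lambda>t. t * (cluster_number t - genfun t (exp (- (Q / t))))) \<longlongrightarrow> limit_mass / (inverse Q + 1)) at_top"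
    using Q by (intro deficit_limit) auto
  from tendsto_diff[OF cluster_number_limit this]
  have "((\<lambda>t. t * genfun t (exp (- (Q / t)))) \<longlongrightarrow> limit_mass - limit_mass / (inverse Q + 1)) at_top"
    by (simp add: algebra_simps)
  also have "limit_mass - limit_mass / (inverse Q + 1) = limit_mass / (Q + 1)"
    using Q by (simp add: field_simps)
  finally show ?thesis by (simp add: Q_def)
qed

sublocale profile: uniform_moment_limit
  "\<lambda>t n. t * c (Suc n) t" "\<lambda>t n. exp (- (real (Suc n) / t))" at_top limit_mass
proof
  show "\<forall>\<^sub>F t in at_top. summable (\<lambda>n. t * c (Suc n) t) \<and>
      (\<forall>n. 0 \<le> t * c (Suc n) t \<and> 0 \<le> exp (- (real (Suc n) / t)) \<and> exp (- (real (Suc n) / t)) \<le> 1)"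
    using eventually_gt_at_top[of 0]
    by eventually_elim (auto intro!: summable_mult c_summable c_nonneg mult_nonneg_nonneg)
  show "((\<lambda>t. \<Sum>n. t * c (Suc n) t * exp (- (real (Suc n) / t)) ^ q) \<longlongrightarrow> limit_mass / (real q + 1)) at_top" for q
    using moment_limit
  proof (rule Lim_transform_eventually)
    show "\<forall>\<^sub>F t in at_top. t * genfun t (exp (- (real q / t))) =
        (\<Sum>n. t * c (Suc n) t * exp (- (real (Suc n) / t)) ^ q)"
      using eventually_gt_at_top[of 0]
    proof eventually_elim
      case (elim t)
      have "exp (- (real q / t)) ^ Suc n = exp (- (real (Suc n) / t)) ^ q" for n
        by (simp only: exp_of_nat_mult[symmetric] mult_minus_right times_divide_eq_right mult.commute)
      moreover have "summable (\<lambda>n. c (Suc n) t * exp (- (real q / t)) ^ Suc n)"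
        using elim by (intro genfun_summable) auto
      ultimately show ?case
        by (simp add: genfun_def suminf_mult[symmetric] mult.assoc del: power_Suc of_nat_Suc)
    qed
  qed
  show "0 \<le> limit_mass" using limit_mass_pos by simp
qed

lemma tail_sum_eq: "tail_sum c (k + 1) t = (\<Sum>n. c (Suc (n + k)) t)"
  by (simp add: tail_sum_def add.commute)

lemma tail_sum_split:
  assumes "t \<ge> 0"
  shows "tail_sum c (k + 1) t = cluster_number t - (\<Sum>n<k. c (Suc n) t)"
  unfolding tail_sum_eq cluster_number_def using c_summable[OF assms] by (rule suminf_minus_initial_segment)

lemma scaled_tail_eq:
  assumes "t > 0" "x \<ge> 0"
  shows "t * tail_sum c (nat \<lfloor>t * x\<rfloor> + 1) t =
    (\<Sum>n. t * c (Suc n) t * of_bool (exp (- (real (Suc n) / t)) < exp (- x)))"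
proof -
  define k where "k = nat \<lfloor>t * x\<rfloor>"
  have tx: "0 \<le> t * x" using assms by simp
  have iff: "exp (- (real (Suc n) / t)) < exp (- x) \<longleftrightarrow> k \<le> n" for n
  proof -
    have "exp (- (real (Suc n) / t)) < exp (- x) \<longleftrightarrow> t * x < real (Suc n)"
      using assms by (simp add: field_simps)
    also have "\<dots> \<longleftrightarrow> k \<le> n"
      using tx unfolding k_def by linarith
    finally show ?thesis .
  qed
  let ?g = "\<lambda>n. t * c (Suc n) t * of_bool (k \<le> n)"
  have "summable ?g"
    using assms c_summable c_nonneg by (intro weighted_sum_bound(1)[where K=1] summable_mult) auto
  from suminf_split_initial_segment[OF this, of k]
  have "suminf ?g = (\<Sum>n. t * c (Suc (n + k)) t)"
    by simp
  also have "\<dots> = t * tail_sum c (k + 1) t"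
    unfolding tail_sum_eq
    using c_summable[of t] assms summable_iff_shift[of "\<lambda>n. c (Suc n) t" k]
    by (intro suminf_mult) simp
  finally show ?thesis
    by (simp only: iff k_def[symmetric])
qed

text \<open>
  For \<open>b = exp (- x)\<close> the distribution function of the points \<open>exp (- n / t)\<close> with weights \<open>t c\<^sub>n(t)\<close>
  is the scaled tail.
\<close>

lemma scaled_tail_uniform_limit:
  assumes "e > 0"
  shows "\<forall>\<^sub>F t in at_top. \<forall>x\<ge>0. \<bar>t * tail_sum c (nat \<lfloor>t * x\<rfloor> + 1) t - limit_mass * exp (- x)\<bar> < e"
  using profile.distribution_function_uniform_limit[OF assms] eventually_gt_at_top[of 0]
proof eventually_elim
  case (elim t)
  show ?case
  proof (intro allI impI)
    fix x :: real assume "x \<ge> 0"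
    then have "exp (- x) \<in> {0..1}" by simp
    from elim(1)[rule_format, OF this]
    show "\<bar>t * tail_sum c (nat \<lfloor>t * x\<rfloor> + 1) t - limit_mass * exp (- x)\<bar> < e"
      unfolding scaled_tail_eq[OF elim(2) \<open>x \<ge> 0\<close>] .
  qed
qed

lemma tail_sum_bounds:
  assumes "t \<ge> 0"
  shows "0 \<le> tail_sum c (k + 1) t" "tail_sum c (k + 1) t \<le> cluster_number t"
proof -
  show "0 \<le> tail_sum c (k + 1) t"
    unfolding tail_sum_eq using c_nonneg[OF assms] c_summable[OF assms] summable_iff_shift[of "\<lambda>n. c (Suc n) t" k]
    by (intro suminf_nonneg) auto
  show "tail_sum c (k + 1) t \<le> cluster_number t"
    unfolding tail_sum_split[OF assms] using c_nonneg[OF assms] by (simp add: sum_nonneg)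
qed

text \<open>
  A cluster counted in the tail has size at least \<open>k + 1\<close>, and the mass is at most \<open>\<rho>\<close>.
\<close>

lemma tail_sum_le:
  assumes "t \<ge> 0"
  shows "tail_sum c (k + 1) t \<le> \<rho> / real (Suc k)"
proof -
  have s: "summable (\<lambda>n. c (Suc (n + k)) t)"
    using c_summable[OF assms] summable_iff_shift[of "\<lambda>n. c (Suc n) t" k] by simp
  have w: "summable (\<lambda>n. real (Suc n) * c (Suc n) t)" using mass_sums[OF assms] by (simp add: sums_iff)
  have "real (Suc k) * tail_sum c (k + 1) t = (\<Sum>n. real (Suc k) * c (Suc (n + k)) t)"
    unfolding tail_sum_eq by (rule suminf_mult[symmetric, OF s])
  also have "\<dots> \<le> (\<Sum>n. real (Suc (n + k)) * c (Suc (n + k)) t)"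
    using w summable_iff_shift[of "\<lambda>n. real (Suc n) * c (Suc n) t" k] c_nonneg[OF assms]
    by (intro suminf_le summable_mult s mult_right_mono) auto
  also have "\<dots> = mass t - (\<Sum>n<k. real (Suc n) * c (Suc n) t)"
    using suminf_minus_initial_segment[OF w, of k] mass_sums[OF assms] by (simp add: sums_iff)
  also have "\<dots> \<le> \<rho>"
    using mass_le[OF assms] c_nonneg[OF assms] sum_nonneg[of "{..<k}" "\<lambda>n. real (Suc n) * c (Suc n) t"] by simp
  finally show ?thesis by (simp add: field_simps)
qed

lemma continuous_on_c: "continuous_on {0..} (c (Suc n))"
  by (rule DERIV_continuous_on[OF c_derivative]) simp

text \<open>
  By \<open>tail_sum_le\<close> the partial sums converge uniformly in time.
\<close>

lemma continuous_on_cluster_number: "continuous_on {0..} cluster_number"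
proof (rule uniform_limit_theorem)
  show "\<forall>\<^sub>F N in sequentially. continuous_on {0..} (\<lambda>t. \<Sum>n<N. c (Suc n) t)"
    by (intro always_eventually allI continuous_on_sum continuous_on_c)
  show "uniform_limit {0..} (\<lambda>N t. \<Sum>n<N. c (Suc n) t) cluster_number sequentially"
  proof (rule uniform_limitI)
    fix e :: real assume "e > 0"
    have "((\<lambda>N. \<rho> / real (Suc N)) \<longlongrightarrow> 0) sequentially"
      by real_asymp
    from order_tendstoD(2)[OF this \<open>e > 0\<close>]
    show "\<forall>\<^sub>F N in sequentially. \<forall>t\<in>{0..}. dist (\<Sum>n<N. c (Suc n) t) (cluster_number t) < e"
    proof eventually_elim
      case (elim N)
      show ?case
      proof
        fix t :: real assume "t \<in> {0..}"
        then have t: "t \<ge> 0" by simp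
        from tail_sum_split[OF t, of N] tail_sum_le[OF t, of N] tail_sum_bounds(1)[OF t, of N] elim
        show "dist (\<Sum>n<N. c (Suc n) t) (cluster_number t) < e"
          by (simp add: dist_real_def)
      qed
    qed
  qed
qed simp

lemma continuous_on_tail_sum: "continuous_on {0..} (tail_sum c (k + 1))"
proof -
  have "continuous_on {0..} (\<lambda>t. cluster_number t - (\<Sum>n<k. c (Suc n) t))"
    by (intro continuous_intros continuous_on_cluster_number continuous_on_c)
  then show ?thesis
    by (rule continuous_on_cong[THEN iffD1, rotated 2]) (auto simp: tail_sum_split simp del: add_Suc_right One_nat_def)
qed

section \<open>The two modes of convergence\<close>

lemma weak_star_profile:
  "weak_star_Linf {0..} (\<lambda>t x. t * tail_sum c (nat \<lfloor>t * x\<rfloor> + 1) t) (\<lambda>x. limit_mass * exp (- x)) at_top"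
proof -
  let ?u = "\<lambda>t x. t * tail_sum c (nat \<lfloor>t * x\<rfloor> + 1) t"
  let ?v = "\<lambda>x. limit_mass * exp (- x)"
  have meas_u: "?u t \<in> borel_measurable (lebesgue_on {0..})" for t
    by (rule borel_measurable_step) simp
  have meas_v: "?v \<in> borel_measurable (lebesgue_on {0..})"
    by (intro measurable_restrict_space1 measurable_completion) simp
  have v_le: "\<bar>?v x\<bar> \<le> limit_mass" if "x \<ge> 0" for x
    using that limit_mass_pos by (simp add: abs_mult)
  have ev: "\<forall>\<^sub>F t in at_top. \<forall>x\<ge>0. \<bar>?u t x\<bar> \<le> limit_mass + 1"
    using scaled_tail_uniform_limit[of 1, simplified]
  proof eventually_elim
    case (elim t)
    show ?case
    proof (intro allI impI)
      fix x :: real assume "x \<ge> 0"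
      then show "\<bar>?u t x\<bar> \<le> limit_mass + 1" using elim[rule_format, of x] v_le[of x] by simp
    qed
  qed
  have "\<forall>\<^sub>F t in at_top. in_Linf {0..} (?u t)"
    using ev
    by eventually_elim
       (use meas_u in \<open>auto simp: in_Linf_def intro!: exI[of _ "limit_mass + 1"] AE_I2\<close>)
  moreover have "in_Linf {0..} ?v"
    using meas_v v_le by (auto simp: in_Linf_def intro!: exI[of _ limit_mass] AE_I2)
  moreover have "((\<lambda>t. LINT x|lebesgue_on {0..}. ?u t x * \<phi> x) \<longlongrightarrow> (LINT x|lebesgue_on {0..}. ?v x * \<phi> x)) at_top"
    if int: "integrable (lebesgue_on {0..}) \<phi>" for \<phi>
  proof (rule integral_dominated_convergence_at_top)
    have \<phi>: "\<phi> \<in> borel_measurable (lebesgue_on {0..})" using int by simp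
    show "(\<lambda>x. ?v x * \<phi> x) \<in> borel_measurable (lebesgue_on {0..})"
      by (intro borel_measurable_times meas_v \<phi>)
    show "(\<lambda>x. ?u t x * \<phi> x) \<in> borel_measurable (lebesgue_on {0..})" for t
      by (intro borel_measurable_times meas_u \<phi>)
    show "integrable (lebesgue_on {0..}) (\<lambda>x. (limit_mass + 1) * \<bar>\<phi> x\<bar>)"
      using int by simp
    have "((\<lambda>t. ?u t x) \<longlongrightarrow> ?v x) at_top" if "x \<ge> 0" for x
    proof (rule tendstoI)
      fix e :: real assume "e > 0"
      from scaled_tail_uniform_limit[OF this]
      show "\<forall>\<^sub>F t in at_top. dist (?u t x) (?v x) < e"
        by eventually_elim (use that in \<open>simp add: dist_real_def\<close>)
    qed
    then show "AE x in lebesgue_on {0..}. ((\<lambda>t. ?u t x * \<phi> x) \<longlongrightarrow> ?v x * \<phi> x) at_top"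
      by (intro AE_I2 tendsto_mult[OF _ tendsto_const]) simp
    show "\<forall>\<^sub>F t in at_top. AE x in lebesgue_on {0..}. norm (?u t x * \<phi> x) \<le> (limit_mass + 1) * \<bar>\<phi> x\<bar>"
      using ev by eventually_elim (intro AE_I2, auto simp: abs_mult intro!: mult_right_mono)
  qed
  ultimately show ?thesis by (simp add: weak_star_Linf_def)
qed

text \<open>
  The change of variables \<open>t \<mapsto> t s\<close>, \<open>x \<mapsto> x / s\<close> reduces the claim to the uniform limit at the times
  \<open>t s \<ge> t a\<close>, with the prefactor \<open>1 / s \<le> 1 / a\<close>.
\<close>

lemma strong_profile:
  assumes a: "0 < a" "a < T" and p: "1 \<le> p"
  shows "converges_C_Lp {a..T} p {0<..<M}
     (\<lambda>t s x. t * tail_sum c (nat \<lfloor>t * x\<rfloor> + 1) (t * s))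
     (\<lambda>s x. limit_mass * (1 / s) * exp (- (x / s))) at_top"
proof -
  let ?u = "\<lambda>t s x. t * tail_sum c (nat \<lfloor>t * x\<rfloor> + 1) (t * s)"
  let ?v = "\<lambda>s x. limit_mass * (1 / s) * exp (- (x / s))"
  have meas_u: "?u t s \<in> borel_measurable (lebesgue_on {0<..<M})" for t s
    by (rule borel_measurable_step) simp
  have meas_v: "?v s \<in> borel_measurable (lebesgue_on {0<..<M})" for s
    by (intro measurable_restrict_space1 measurable_completion) simp
  have "in_C_Lp {a..T} p {0<..<M} (?u t)" if t: "t > 0" for t
  proof (rule uniformly_continuous_imp_in_C_Lp[OF meas_u _ _ p])
    fix s assume s: "s \<in> {a..T}"
    then have ts: "t * s \<ge> 0" using t a by simp
    have "\<bar>?u t s x\<bar> \<le> t * cluster_number (t * s)" for x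
      using tail_sum_bounds[OF ts, of "nat \<lfloor>t * x\<rfloor>"] t by (simp add: abs_mult)
    then show "\<exists>K. \<forall>x\<in>{0<..<M}. \<bar>?u t s x\<bar> \<le> K" by blast
    fix e :: real assume e: "e > 0"
    have cont: "continuous_on {a..T} (\<lambda>r. t * tail_sum c (k + 1) (t * r))" for k
      using t a
      by (intro continuous_on_mult[OF continuous_on_const] continuous_on_compose2[OF continuous_on_tail_sum]
          continuous_on_id) auto
    \<comment> \<open>Only finitely many tails occur for \<open>x < M\<close>, so their continuity in time is uniform in \<open>x\<close>.\<close>
    have "\<forall>\<^sub>F r in at s within {a..T}. \<forall>k\<in>{..nat \<lfloor>t * M\<rfloor>}.
        \<bar>t * tail_sum c (k + 1) (t * r) - t * tail_sum c (k + 1) (t * s)\<bar> < e"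
    proof (rule eventually_ball_finite)
      show "\<forall>k\<in>{..nat \<lfloor>t * M\<rfloor>}. \<forall>\<^sub>F r in at s within {a..T}.
          \<bar>t * tail_sum c (k + 1) (t * r) - t * tail_sum c (k + 1) (t * s)\<bar> < e"
      proof
        fix k
        have "((\<lambda>r. t * tail_sum c (k + 1) (t * r)) \<longlongrightarrow> t * tail_sum c (k + 1) (t * s)) (at s within {a..T})"
          using cont[of k] s unfolding continuous_on by blast
        from tendstoD[OF this e]
        show "\<forall>\<^sub>F r in at s within {a..T}.
            \<bar>t * tail_sum c (k + 1) (t * r) - t * tail_sum c (k + 1) (t * s)\<bar> < e"
          unfolding dist_real_def .
      qed
    qed simp
    then show "\<forall>\<^sub>F r in at s within {a..T}. \<forall>x\<in>{0<..<M}. \<bar>?u t r x - ?u t s x\<bar> < e"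
    proof eventually_elim
      case (elim r)
      show ?case
      proof
        fix x assume "x \<in> {0<..<M}"
        then have "t * x \<le> t * M" using t by simp
        then have "nat \<lfloor>t * x\<rfloor> \<le> nat \<lfloor>t * M\<rfloor>" by (intro nat_mono floor_mono)
        then show "\<bar>?u t r x - ?u t s x\<bar> < e" using elim by blast
      qed
    qed
  qed
  then have 1: "\<forall>\<^sub>F t in at_top. in_C_Lp {a..T} p {0<..<M} (?u t)"
    using eventually_gt_at_top[of 0] by (rule eventually_mono[rotated])
  have 2: "in_C_Lp {a..T} p {0<..<M} ?v"
  proof (rule uniformly_continuous_imp_in_C_Lp[OF meas_v _ _ p])
    fix s assume s: "s \<in> {a..T}"
    have "\<bar>?v s x\<bar> \<le> limit_mass * (1 / s) * 1" if "x \<in> {0<..<M}" for x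
      using that s a limit_mass_pos unfolding abs_mult by (intro mult_mono) auto
    then show "\<exists>K. \<forall>x\<in>{0<..<M}. \<bar>?v s x\<bar> \<le> K" by blast
    fix e :: real assume e: "e > 0"
    have "uniformly_continuous_on ({a..T} \<times> {0..M}) (\<lambda>z. ?v (fst z) (snd z))"
      using a by (intro compact_uniformly_continuous continuous_intros compact_Times) auto
    then obtain d where d: "d > 0" "\<And>z z'. z \<in> {a..T} \<times> {0..M} \<Longrightarrow> z' \<in> {a..T} \<times> {0..M} \<Longrightarrow>
        dist z' z < d \<Longrightarrow> dist (?v (fst z') (snd z')) (?v (fst z) (snd z)) < e"
      using e unfolding uniformly_continuous_on_def by metis
    have "\<forall>\<^sub>F r in at s within {a..T}. r \<in> {a..T} \<and> dist r s < d"
      using d(1) by (auto simp: eventually_at intro!: exI[of _ d])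
    then show "\<forall>\<^sub>F r in at s within {a..T}. \<forall>x\<in>{0<..<M}. \<bar>?v r x - ?v s x\<bar> < e"
    proof eventually_elim
      case (elim r)
      show ?case
      proof
        fix x assume x: "x \<in> {0<..<M}"
        show "\<bar>?v r x - ?v s x\<bar> < e"
          using d(2)[of "(s, x)" "(r, x)"] elim s x by (simp add: dist_Pair_Pair dist_real_def)
      qed
    qed
  qed
  have 3: "uniform_limit {a..T} (\<lambda>t s. Lp_norm p {0<..<M} (\<lambda>x. ?u t s x - ?v s x)) (\<lambda>s. 0) at_top"
  proof (rule uniformly_small_imp_Lp_norm_small[OF _ _ p])
    show "\<forall>\<^sub>F t in at_top. \<forall>s\<in>{a..T}. (\<lambda>x. ?u t s x - ?v s x) \<in> borel_measurable (lebesgue_on {0<..<M})"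
      by (intro always_eventually allI ballI borel_measurable_diff meas_u meas_v)
    fix e :: real assume e: "e > 0"
    then have "e * a > 0" using a by simp
    from scaled_tail_uniform_limit[OF this] obtain \<tau> where
      \<tau>: "\<And>t x. t \<ge> \<tau> \<Longrightarrow> x \<ge> 0 \<Longrightarrow>
        \<bar>t * tail_sum c (nat \<lfloor>t * x\<rfloor> + 1) t - limit_mass * exp (- x)\<bar> < e * a"
      unfolding eventually_at_top_linorder by blast
    show "\<forall>\<^sub>F t in at_top. \<forall>s\<in>{a..T}. \<forall>x\<in>{0<..<M}. \<bar>?u t s x - ?v s x\<bar> < e"
      using eventually_ge_at_top[of "max 0 \<tau> / a"]
    proof eventually_elim
      case (elim t)
      then have t: "t * a \<ge> max 0 \<tau>" using a by (simp add: field_simps)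
      then have "t \<ge> 0" using a by (simp add: zero_le_mult_iff)
      show ?case
      proof (intro ballI)
        fix s x assume s: "s \<in> {a..T}" and x: "x \<in> {0<..<M}"
        have s0: "s > 0" "s \<ge> a" using s a by auto
        have "t * s \<ge> t * a" using s0 \<open>t \<ge> 0\<close> by (intro mult_left_mono)
        then have "\<bar>t * s * tail_sum c (nat \<lfloor>t * s * (x / s)\<rfloor> + 1) (t * s) - limit_mass * exp (- (x / s))\<bar> < e * a"
          using t s0 x by (intro \<tau>) auto
        also have "t * s * (x / s) = t * x" using s0 by simp
        also have "t * s * tail_sum c (nat \<lfloor>t * x\<rfloor> + 1) (t * s) - limit_mass * exp (- (x / s))
            = s * (?u t s x - ?v s x)"
          using s0 by (simp add: field_simps)
        finally have "s * \<bar>?u t s x - ?v s x\<bar> < e * a"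
          using s0 by (simp add: abs_mult)
        also have "e * a \<le> s * e" using e s0 by simp
        finally show "\<bar>?u t s x - ?v s x\<bar> < e"
          using s0 by simp
      qed
    qed
  qed
  show ?thesis using 1 2 3 by (simp add: converges_C_Lp_def)
qed

end

theorem theorem4:
  fixes \<kappa> \<rho> :: real and f :: "real \<Rightarrow> real" and c :: "nat \<Rightarrow> real \<Rightarrow> real"
  assumes "\<kappa> > 0"
    and "cluster_solution \<kappa> \<rho> f c"
    and "\<rho> > 1 / \<kappa>"
    and "f 0 < \<rho>"
  shows "weak_star_Linf {0..}
           (\<lambda>t x. t * tail_sum c (nat \<lfloor>t * x\<rfloor> + 1) t)
           (\<lambda>x. (\<rho> - 1 / \<kappa>) * exp (- x)) at_top \<and>
         (\<forall>a T p M :: real. 0 < a \<longrightarrow> a < T \<longrightarrow> 1 \<le> p \<longrightarrow>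
           converges_C_Lp {a..T} p {0<..<M}
             (\<lambda>t s x. t * tail_sum c (nat \<lfloor>t * x\<rfloor> + 1) (t * s))
             (\<lambda>s x. (\<rho> - 1 / \<kappa>) * (1 / s) * exp (- (x / s))) at_top)"
proof -
  interpret supercritical_solution \<kappa> \<rho> f c
    using assms by unfold_locales
  show ?thesis
    using weak_star_profile strong_profile by (simp add: limit_mass_def)
qed

end
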